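(* Let $m>4$ and let $\lambda$ be a trivial coloring on $\mathrm{P}^3(m)$ with $\lambda(c)=\lambda(f)=e_1$. If $\lambda$ is 3-independent with the property $(\star)$, then $\lambda$ is sector-equivalent to one of the following six canonical forms: (1) $\lambda_{C_5}$ with $m$ odd and coloring sequence $\mathcal{C}_5=(\bar\gamma,\alpha,\beta,\dots,\alpha,\beta)$; (2) $\lambda_{C_6}$ with $m$ odd and coloring sequence $\mathcal{C}_6=(\bar\gamma,\bar\alpha,\beta,\alpha,\beta,\dots,\alpha,\beta)$; (3) $\lambda_{C_7}$ with $m$ odd and coloring sequence $\mathcal{C}_7=(\gamma,\bar\alpha,\beta,\alpha,\beta,\dots,\alpha,\beta)$; (4) $\lambda_{C_8}$ with $m$ even and coloring sequence $\mathcal{C}_8=(\bar\alpha,\gamma,\bar\alpha,\beta,\alpha,\beta,\dots,\alpha,\beta)$; (5) $\lambda_{C_9}$ with $m$ even and coloring sequence $\mathcal{C}_9=(\alpha,\gamma,\bar\alpha,\beta,\alpha,\beta,\dots,\alpha,\beta)$; (6) $\lambda_{C_{10}}$ with $m$ even and coloring sequence $\mathcal{C}_{10}=(\alpha,\bar\gamma,\alpha,\beta,\dots,\alpha,\beta)$.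
   Context: $\mathrm{P}^3(m)=[0,1]\times(m\text{-gon})$, with ceiling $c$ and floor $f$ (the two $m$-gon faces) and side faces $s_1,\dots,s_m$ in cyclic order. A coloring $\lambda$ assigns to each facet a vector of $(\mathbb{Z}_2)^3$ such that facets with nonempty common intersection get linearly independent vectors. $\lambda$ is trivial if $\lambda(c)=\lambda(f)$; it is 2-independent if $\lambda(s_1),\dots,\lambda(s_m)$ span a 2-dimensional subspace of $(\mathbb{Z}_2)^3$, and 3-independent otherwise. Fix a basis $\{e_1,\alpha,\beta\}$ of $(\mathbb{Z}_2)^3$ and put $\gamma=\alpha+\beta$, $\bar\alpha=\alpha+e_1$, $\bar\beta=\beta+e_1$, $\bar\gamma=\gamma+e_1$. A trivial coloring with $\lambda(c)=\lambda(f)=e_1$ is described by its coloring sequence $(\lambda(s_1),\dots,\lambda(s_m))$, viewed cyclically; the canonical forms $\lambda_{C_i}$ are the colorings with ceiling and floor colored $e_1$ and side sequence $\mathcal{C}_i$ (dots denote repetition of $\alpha,\beta$). $\lambda$ has property $(\star)$ if each of the three letters $\alpha,\beta,\gamma$ (each with or without bar) appears in its coloring sequence. Sector-equivalence of trivial colorings is the equivalence relation generated by: (i) $\lambda\mapsto\sigma\circ\lambda$ with $\sigma\in\mathrm{GL}(3,\mathbb{Z}_2)$ (Davis–Januszkiewicz equivalence); (ii) cyclic rotation or reversal of the order of the side faces; (iii) the following operations for $k<l$, which change only the colors of the block $s_k,s_{k+1},\dots,s_l$: $\mathrm{O}_1$: if $\lambda(s_k)=\lambda(s_l)$, reverse the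 block. $\mathrm{O}_{21}$: if $\lambda(s_k)=\lambda(s_l)+\lambda(c)$, apply to each entry of the block the linear map that is the identity on $\mathrm{Span}\{\lambda(c),\lambda(s_k)\}$ and sends each $v$ outside it to $v+\lambda(c)$. $\mathrm{O}_{22}$: if $\lambda(s_k)=\lambda(s_l)+\lambda(c)$, choose $w$ with $\{\lambda(c),\lambda(s_k),w\}$ a basis, reverse the block, and apply to each entry the linear map $\lambda(c)\mapsto\lambda(c)$, $\lambda(s_k)\mapsto\lambda(s_l)$, $w\mapsto w$. $\mathrm{O}_{32}$: if $\lambda(s_k),\lambda(s_l),\lambda(c)$ are linearly independent, reverse the block and apply to each entry the linear map fixing $\lambda(c)$ and interchanging $\lambda(s_k)$ and $\lambda(s_l)$. *)

theory Defs
  imports "HOL-Analysis.Analysis" "HOL-Library.Z2"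
begin

type_synonym vec3 = "bit ^ 3"

datatype facet = Ceil | Floor | Side nat

definition facets :: "nat \<Rightarrow> facet set" where
  "facets m = {Ceil, Floor} \<union> Side ` {..<m}"

text \<open>Facets of the prism \<open>[0,1] \<times> m-gon\<close> as vertex sets: the vertex \<open>(t, j)\<close> is the
  \<open>j\<close>-th vertex of the \<open>m\<close>-gon at height 1 (\<open>t = True\<close>) or 0, and side \<open>i\<close> lies over the
  polygon edge from vertex \<open>i\<close> to vertex \<open>i + 1\<close> modulo \<open>m\<close>. An intersection of facets is a
  face, so it is nonempty iff it contains a vertex.\<close>

fun facet_verts :: "nat \<Rightarrow> facet \<Rightarrow> (bool \<times> nat) set" where
  "facet_verts m Ceil = {True} \<times> {..<m}"
| "facet_verts m Floor = {False} \<times> {..<m}"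
| "facet_verts m (Side i) = UNIV \<times> {i, (i + 1) mod m}"

text \<open>An assignment of vectors to the facets; the side faces are numbered from 0, and the
  number \<open>m\<close> of sides is the length of the list.\<close>

datatype facet_coloring = Coloring (ceil_col: vec3) (floor_col: vec3) (side_cols: "vec3 list")

fun col :: "facet_coloring \<Rightarrow> facet \<Rightarrow> vec3" where
  "col lam Ceil = ceil_col lam"
| "col lam Floor = floor_col lam"
| "col lam (Side i) = side_cols lam ! i"

definition coloring :: "nat \<Rightarrow> facet_coloring \<Rightarrow> bool" where
  "coloring m lam \<longleftrightarrow>
     length (side_cols lam) = m \<and>
     (\<forall>K. K \<subseteq> facets m \<and> K \<noteq> {} \<and> (\<Inter>F\<in>K. facet_verts m F) \<noteq> {} \<longrightarrow>
        inj_on (col lam) K \<and> vec.independent (col lam ` K))"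

definition trivial_coloring :: "nat \<Rightarrow> facet_coloring \<Rightarrow> bool" where
  "trivial_coloring m lam \<longleftrightarrow> coloring m lam \<and> ceil_col lam = floor_col lam"

definition two_independent :: "facet_coloring \<Rightarrow> bool" where
  "two_independent lam \<longleftrightarrow> vec.dim (vec.span (set (side_cols lam))) = 2"

definition three_independent :: "facet_coloring \<Rightarrow> bool" where
  "three_independent lam \<longleftrightarrow> \<not> two_independent lam"

definition basis3 :: "vec3 \<Rightarrow> vec3 \<Rightarrow> vec3 \<Rightarrow> bool" where
  "basis3 u v w \<longleftrightarrow> distinct [u, v, w] \<and> vec.independent {u, v, w} \<and> vec.span {u, v, w} = UNIV"

abbreviation lin :: "(vec3 \<Rightarrow> vec3) \<Rightarrow> bool" where
  "lin T \<equiv> Vector_Spaces.linear (*s) (*s) T"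

definition property_star :: "vec3 \<Rightarrow> vec3 \<Rightarrow> vec3 \<Rightarrow> facet_coloring \<Rightarrow> bool" where
  "property_star e1 \<alpha> \<beta> lam \<longleftrightarrow>
     (\<forall>x \<in> {\<alpha>, \<beta>, \<alpha> + \<beta>}. x \<in> set (side_cols lam) \<or> x + e1 \<in> set (side_cols lam))"

text \<open>Apply \<open>f\<close> to the block of entries with indices \<open>k, ..., l\<close>.\<close>

definition on_block :: "nat \<Rightarrow> nat \<Rightarrow> ('a list \<Rightarrow> 'a list) \<Rightarrow> 'a list \<Rightarrow> 'a list" where
  "on_block k l f xs = take k xs @ f (drop k (take (Suc l) xs)) @ drop (Suc l) xs"

inductive sector_step :: "facet_coloring \<Rightarrow> facet_coloring \<Rightarrow> bool" where
  DJ: "lin \<sigma> \<Longrightarrow> bij \<sigma> \<Longrightarrow>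
    sector_step (Coloring c f xs) (Coloring (\<sigma> c) (\<sigma> f) (map \<sigma> xs))"
| rotation: "sector_step (Coloring c f xs) (Coloring c f (rotate n xs))"
| reversal: "sector_step (Coloring c f xs) (Coloring c f (rev xs))"
| O1: "k < l \<Longrightarrow> l < length xs \<Longrightarrow> xs ! k = xs ! l \<Longrightarrow>
    sector_step (Coloring c f xs) (Coloring c f (on_block k l rev xs))"
| O21: "k < l \<Longrightarrow> l < length xs \<Longrightarrow> xs ! k = xs ! l + c \<Longrightarrow>
    lin T \<Longrightarrow> (\<And>v. v \<in> vec.span {c, xs ! k} \<Longrightarrow> T v = v) \<Longrightarrow>
    (\<And>v. v \<notin> vec.span {c, xs ! k} \<Longrightarrow> T v = v + c) \<Longrightarrow>
    sector_step (Coloring c f xs) (Coloring c f (on_block k l (map T) xs))"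
| O22: "k < l \<Longrightarrow> l < length xs \<Longrightarrow> xs ! k = xs ! l + c \<Longrightarrow>
    basis3 c (xs ! k) w \<Longrightarrow>
    lin T \<Longrightarrow> T c = c \<Longrightarrow> T (xs ! k) = xs ! l \<Longrightarrow> T w = w \<Longrightarrow>
    sector_step (Coloring c f xs) (Coloring c f (on_block k l (\<lambda>b. map T (rev b)) xs))"
| O32: "k < l \<Longrightarrow> l < length xs \<Longrightarrow> basis3 c (xs ! k) (xs ! l) \<Longrightarrow>
    lin T \<Longrightarrow> T c = c \<Longrightarrow> T (xs ! k) = xs ! l \<Longrightarrow> T (xs ! l) = xs ! k \<Longrightarrow>
    sector_step (Coloring c f xs) (Coloring c f (on_block k l (\<lambda>b. map T (rev b)) xs))"

definition sector_equivalent :: "nat \<Rightarrow> facet_coloring \<Rightarrow> facet_coloring \<Rightarrow> bool" where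
  "sector_equivalent m =
     equivclp (\<lambda>lam mu. trivial_coloring m lam \<and> trivial_coloring m mu \<and> sector_step lam mu)"

text \<open>The coloring with ceiling and floor \<open>e1\<close> whose side sequence starts with \<open>pre\<close> and
  continues with \<open>\<alpha>, \<beta>, ..., \<alpha>, \<beta>\<close> up to length \<open>m\<close>. The number of pairs is
  \<open>(m - length pre) div 2\<close>, which gives length \<open>m\<close> only if \<open>m\<close> has the parity of
  \<open>length pre\<close> (and \<open>length pre \<le> m\<close>).\<close>

definition canonical :: "vec3 \<Rightarrow> vec3 \<Rightarrow> vec3 \<Rightarrow> vec3 list \<Rightarrow> nat \<Rightarrow> facet_coloring" where
  "canonical e1 \<alpha> \<beta> pre m =
     Coloring e1 e1 (pre @ concat (replicate ((m - length pre) div 2) [\<alpha>, \<beta>]))"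

definition lam_C5 :: "vec3 \<Rightarrow> vec3 \<Rightarrow> vec3 \<Rightarrow> nat \<Rightarrow> facet_coloring" where
  "lam_C5 e1 \<alpha> \<beta> = (let \<gamma> = \<alpha> + \<beta> in canonical e1 \<alpha> \<beta> [\<gamma> + e1])"

definition lam_C6 :: "vec3 \<Rightarrow> vec3 \<Rightarrow> vec3 \<Rightarrow> nat \<Rightarrow> facet_coloring" where
  "lam_C6 e1 \<alpha> \<beta> = (let \<gamma> = \<alpha> + \<beta> in canonical e1 \<alpha> \<beta> [\<gamma> + e1, \<alpha> + e1, \<beta>])"

definition lam_C7 :: "vec3 \<Rightarrow> vec3 \<Rightarrow> vec3 \<Rightarrow> nat \<Rightarrow> facet_coloring" where
  "lam_C7 e1 \<alpha> \<beta> = (let \<gamma> = \<alpha> + \<beta> in canonical e1 \<alpha> \<beta> [\<gamma>, \<alpha> + e1, \<beta>])"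

definition lam_C8 :: "vec3 \<Rightarrow> vec3 \<Rightarrow> vec3 \<Rightarrow> nat \<Rightarrow> facet_coloring" where
  "lam_C8 e1 \<alpha> \<beta> = (let \<gamma> = \<alpha> + \<beta> in canonical e1 \<alpha> \<beta> [\<alpha> + e1, \<gamma>, \<alpha> + e1, \<beta>])"

definition lam_C9 :: "vec3 \<Rightarrow> vec3 \<Rightarrow> vec3 \<Rightarrow> nat \<Rightarrow> facet_coloring" where
  "lam_C9 e1 \<alpha> \<beta> = (let \<gamma> = \<alpha> + \<beta> in canonical e1 \<alpha> \<beta> [\<alpha>, \<gamma>, \<alpha> + e1, \<beta>])"

definition lam_C10 :: "vec3 \<Rightarrow> vec3 \<Rightarrow> vec3 \<Rightarrow> nat \<Rightarrow> facet_coloring" where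
  "lam_C10 e1 \<alpha> \<beta> = (let \<gamma> = \<alpha> + \<beta> in canonical e1 \<alpha> \<beta> [\<alpha>, \<gamma> + e1])"

end

theory Submission
  imports Defs "HOL-Combinatorics.Transposition"
begin

text \<open>Modulo \<open>e1\<close> a side color is one of three letters, so a trivial coloring is a cyclic word in
  the letters \<open>\<alpha>, \<beta>, \<gamma>\<close>, adjacent letters being different, with a bar or not on each.

  On letters, every block may be reflected: reverse it and exchange the letters at its ends. With
  \<open>t, s, r\<close> letters other than \<open>\<gamma>\<close> and \<open>s \<noteq> r\<close>, this gives \<open>t \<gamma> s r \<rightarrow> t s' \<gamma> r\<close>, which shortens the gap
  to the next \<open>\<gamma>\<close>, and \<open>t \<gamma> s \<gamma> \<rightarrow> t s t \<gamma>\<close> for \<open>s \<noteq> t\<close>, which removes a \<open>\<gamma>\<close>. Hence a single \<open>\<gamma>\<close>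
  can be reached, followed by an alternating word in \<open>\<alpha>\<close> and \<open>\<beta>\<close>.

  The bars of that alternating word are then rearranged by \<open>O21\<close> alone. If one of the two letters
  occurs both with and without a bar, the word can be turned into every other such word of the same
  length (at least 4) with the same ends; otherwise a linear map removes all its bars. Linear maps
  also normalize the ends, and 3-independence, which all moves preserve, rules out the words
  without any bars.\<close>

section \<open>Words of letters\<close>

text \<open>\<open>A, B, C\<close> stand for \<open>\<alpha>, \<beta>, \<gamma>\<close>, and the Boolean tells whether the letter has a bar.\<close>

datatype ty = A | B | C

type_synonym letter = "ty \<times> bool"

abbreviation exchange :: "ty \<Rightarrow> ty \<Rightarrow> ty \<Rightarrow> ty" where
  "exchange \<equiv> Transposition.transpose"

text \<open>For injective \<open>p\<close> and additive \<open>f\<close> the maps \<open>act p f\<close> are the invertible linear maps fixing \<open>e1\<close>,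
  since \<open>\<gamma> = \<alpha> + \<beta>\<close>.\<close>

fun act :: "(ty \<Rightarrow> ty) \<Rightarrow> (ty \<Rightarrow> bool) \<Rightarrow> letter \<Rightarrow> letter" where
  "act p f (t, b) = (p t, b \<noteq> f t)"

text \<open>Equivalently, \<open>f\<close> holds at none or at exactly two of the three types, so
  the condition is symmetric in them.\<close>

definition additive :: "(ty \<Rightarrow> bool) \<Rightarrow> bool" where
  "additive f \<longleftrightarrow> f C = (f A \<noteq> f B)"

text \<open>For letters of different types this is the linear map of \<open>O32\<close>: it fixes
  \<open>e1\<close>, interchanges the vectors of \<open>x\<close> and \<open>y\<close> and hence
  fixes their sum, which has the third type.\<close>

definition swap :: "letter \<Rightarrow> letter \<Rightarrow> letter \<Rightarrow> letter" where
  "swap x y = act (exchange (fst x) (fst y))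
     (\<lambda>t. (t = fst x \<or> t = fst y) \<and> snd x \<noteq> snd y)"

text \<open>In \<open>O22\<close> the two linear maps allowed by the choice of \<open>w\<close> correspond to the two values of \<open>t'\<close>;
  \<open>w\<close> is then a vector of the third type.\<close>

inductive wstep :: "letter list \<Rightarrow> letter list \<Rightarrow> bool" where
  act: "inj p \<Longrightarrow> additive f \<Longrightarrow> wstep w (map (act p f) w)"
| rot: "wstep (u @ v) (v @ u)"
| O1: "wstep (u @ x # v @ x # z) (u @ x # rev v @ x # z)"
| O21: "b \<noteq> c \<Longrightarrow> wstep (u @ (t, b) # v @ (t, c) # z)
    (u @ (t, b) # map (act id (\<lambda>s. s \<noteq> t)) v @ (t, c) # z)"
| O22: "b \<noteq> c \<Longrightarrow> t \<noteq> t' \<Longrightarrow> wstep (u @ (t, b) # v @ (t, c) # z)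
    (u @ (t, b) # map (act id (\<lambda>s. s = t \<or> s = t')) (rev v) @ (t, c) # z)"
| O32: "fst x \<noteq> fst y \<Longrightarrow>
    wstep (u @ x # v @ y # z) (u @ x # map (swap x y) (rev v) @ y # z)"

text \<open>Repeating the first entry at the end turns the cyclic condition on neighbours into a
  linear one.\<close>

definition proper :: "ty list \<Rightarrow> bool" where
  "proper ts \<longleftrightarrow> successively (\<noteq>) (ts @ [hd ts])"

section \<open>Invariants of the moves\<close>

lemma wstep_length: "wstep w w' \<Longrightarrow> length w' = length w"
  by (induction rule: wstep.induct) auto

lemma fst_act: "fst (act p f x) = p (fst x)"
  by (cases x) auto

lemma fst_swap: "fst (swap x y z) = exchange (fst x) (fst y) (fst z)"
  by (simp add: swap_def fst_act)

lemma successively_map_inj: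
  "inj p \<Longrightarrow> successively (\<noteq>) (map p ts) \<longleftrightarrow> successively (\<noteq>) ts"
  by (simp add: successively_map inj_eq)

lemma successively_neq_rev: "successively (\<noteq>) (rev ts) \<longleftrightarrow> successively (\<noteq>) ts"
  by (simp add: successively_rev neq_commute)

lemma successively_join:
  "successively P (u @ x # v) \<longleftrightarrow> successively P (u @ [x]) \<and> successively P (x # v)"
  by (auto simp: successively_append_iff successively_Cons)

text \<open>The inside of a block meets the rest of the word only at \<open>s\<close> and
  \<open>t\<close>. This includes the cyclic closure, because the first entry of the word is the
  head of \<open>u @ [s]\<close>.\<close>

lemma proper_block:
  assumes "proper (u @ s # v @ t # z)"
    and "successively (\<noteq>) (s # v @ [t]) \<Longrightarrow> successively (\<noteq>) (s # v' @ [t])"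
  shows "proper (u @ s # v' @ t # z)"
proof -
  have split: "proper (u @ s # w @ t # z) \<longleftrightarrow> successively (\<noteq>) (u @ [s]) \<and>
      successively (\<noteq>) (s # w @ [t]) \<and> successively (\<noteq>) (t # z @ [hd (u @ [s])])" for w
  proof -
    have "hd (u @ s # w @ t # z) = hd (u @ [s])" by (cases u) auto
    then show ?thesis
      unfolding proper_def
      using successively_join[of "(\<noteq>)" u s "w @ t # z @ [hd (u @ [s])]"]
        successively_join[of "(\<noteq>)" "s # w" t "z @ [hd (u @ [s])]"] by simp
  qed
  show ?thesis using assms unfolding split by blast
qed

lemma proper_rotate: "proper (u @ v) \<longleftrightarrow> proper (v @ u)"
proof (cases "u = [] \<or> v = []")
  case False
  then obtain a u' b v' where "u = a # u'" "v = b # v'" by (meson list.exhaust)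
  then show ?thesis
    using successively_join[of "(\<noteq>)" "a # u'" b "v' @ [a]"]
      successively_join[of "(\<noteq>)" "b # v'" a "u' @ [b]"]
    by (auto simp: proper_def)
qed auto

lemma inj_exchange: "inj (exchange (s :: ty) t)"
  by (simp add: bij_is_inj)

text \<open>The reflected block, ends included, is the image of the reversed block under the
  injective map \<open>exchange s t\<close>.\<close>

lemma successively_reflect:
  "successively (\<noteq>) (s # map (exchange s t) (rev v) @ [t :: ty]) \<longleftrightarrow>
   successively (\<noteq>) (s # v @ [t])"
proof -
  have "s # map (exchange s t) (rev v) @ [t] = map (exchange s t) (rev (s # v @ [t]))"
    by simp
  then show ?thesis
    by (metis inj_exchange successively_map_inj successively_neq_rev)
qed

text \<open>On types every move is an injective relabelling, a rotation, a reflection of a block, or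
  the identity.\<close>

lemma wstep_proper: "wstep w w' \<Longrightarrow> proper (map fst w) \<Longrightarrow> proper (map fst w')"
proof (induction rule: wstep.induct)
  case (act p f w)
  have "map fst (map (act p f) w) = map p (map fst w)" by (simp add: fst_act)
  moreover have "proper (map p ts)" if "proper ts" for ts
  proof (cases "ts = []")
    case False
    then have "map p ts @ [hd (map p ts)] = map p (ts @ [hd ts])"
      by (simp add: hd_map)
    then show ?thesis using that \<open>inj p\<close> by (metis proper_def successively_map_inj)
  qed (use that in simp)
  ultimately show ?case using act by metis
next
  case (rot u v)
  then show ?case using proper_rotate by simp
next
  case (O1 u x v z)
  then show ?case
    using proper_block[of "map fst u" "fst x" "map fst v" "fst x" "map fst z" "rev (map fst v)"]
      successively_reflect[of "fst x" "fst x" "map fst v"]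
    by (simp add: rev_map)
next
  case (O21 b c u t v z)
  then show ?case by (simp add: fst_act comp_def)
next
  case (O22 b c t t' u v z)
  then show ?case
    using proper_block[of "map fst u" t "map fst v" t "map fst z" "rev (map fst v)"]
      successively_reflect[of t t "map fst v"]
    by (simp add: rev_map fst_act comp_def)
next
  case (O32 x y u v z)
  then show ?case
    using proper_block[of "map fst u" "fst x" "map fst v" "fst y" "map fst z"
        "map (exchange (fst x) (fst y)) (rev (map fst v))"]
      successively_reflect[of "fst x" "fst y" "map fst v"]
    by (simp add: rev_map fst_swap comp_def)
qed

text \<open>A flat word is one whose vectors lie in a plane complementary to \<open>e1\<close>.\<close>

definition flat :: "letter list \<Rightarrow> bool" where
  "flat w \<longleftrightarrow> (\<exists>f. additive f \<and> (\<forall>x\<in>set w. snd x = f (fst x)))"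

text \<open>Stated backwards because non-flatness has to survive the moves. The cases
  \<open>O21\<close> and \<open>O22\<close> are vacuous: a flat word never has one type with two
  different bars.\<close>

lemma wstep_flat: "wstep w w' \<Longrightarrow> flat w' \<Longrightarrow> flat w"
proof (induction rule: wstep.induct)
  case (act p f w)
  then obtain g where g: "additive g" "\<forall>x\<in>set w. snd (act p f x) = g (p (fst x))"
    by (auto simp: flat_def fst_act)
  have "p A \<noteq> p B" "p A \<noteq> p C" "p B \<noteq> p C" using \<open>inj p\<close> by (auto simp: inj_eq)
  \<comment> \<open>The functional of the target is pulled back along the linear map;
    \<open>p\<close> permutes the three types, so additivity survives.\<close>
  then have "additive (\<lambda>t. g (p t) \<noteq> f t)" using g(1) \<open>additive f\<close> 
    by (cases "p A"; cases "p B"; cases "p C") (auto simp: additive_def)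
  moreover have "snd x = (g (p (fst x)) \<noteq> f (fst x))" if "x \<in> set w" for x
    using g(2) that by (cases x) fastforce
  ultimately show ?case unfolding flat_def by blast
next
  case (rot u v)
  then show ?case by (simp add: flat_def Un_commute)
next
  case (O1 u x v z)
  then show ?case by (simp add: flat_def)
next
  case (O21 b c u t v z)
  then show ?case by (auto simp: flat_def)
next
  case (O22 b c t t' u v z)
  then show ?case by (auto simp: flat_def)
next
  case (O32 x y u v z)
  obtain s b t c where xy: "x = (s, b)" "y = (t, c)" by fastforce
  obtain f where f: "additive f"
      "\<forall>a \<in> set (u @ x # map (swap x y) v @ y # z). snd a = f (fst a)"
    using O32.prems by (auto simp: flat_def)
  \<comment> \<open>Both \<open>x\<close> and \<open>y\<close> lie in the plane given by
    \<open>f\<close>, so the linear map \<open>swap x y\<close> preserves this plane.\<close>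
  have "snd a = f (fst a)" if "a \<in> set v" for a
  proof -
    have "snd (swap x y a) = f (fst (swap x y a))" "b = f s" "c = f t"
      using f(2) that xy by auto
    moreover obtain r d where "a = (r, d)" by fastforce
    ultimately show ?thesis using xy O32.hyps f(1)
      by (cases s; cases t; cases r) (auto simp: swap_def additive_def)
  qed
  then have "\<forall>a \<in> set (u @ x # v @ y # z). snd a = f (fst a)" using f(2) by auto
  then show ?case using f(1) unfolding flat_def by blast
qed

section \<open>Moves on types, with the bars forgotten\<close>

definition reaches :: "ty list \<Rightarrow> ty list \<Rightarrow> bool" where
  "reaches ts ts' \<longleftrightarrow>
     (\<forall>w. map fst w = ts \<longrightarrow> (\<exists>w'. wstep\<^sup>*\<^sup>* w w' \<and> map fst w' = ts'))"

lemma reaches_trans [trans]: "reaches r s \<Longrightarrow> reaches s t \<Longrightarrow> reaches r t"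
  unfolding reaches_def by (metis (no_types, lifting) rtranclp_trans)

lemma reaches_rotate: "reaches (u @ v) (v @ u)"
  unfolding reaches_def
  by (metis append_eq_map_conv map_append r_into_rtranclp wstep.rot)

text \<open>The bars only decide which move performs the reflection: \<open>O1\<close> for equal end
  letters, \<open>O22\<close> for equal types with different bars, \<open>O32\<close> for different
  types.\<close>

lemma reaches_block:
  "reaches (u @ s # v @ t # z) (u @ s # map (exchange s t) (rev v) @ t # z)"
  unfolding reaches_def
proof (intro allI impI)
  fix w :: "letter list"
  assume "map fst w = u @ s # v @ t # z"
  then obtain u' b v' c z' where w: "w = u' @ (s, b) # v' @ (t, c) # z'"
    and m: "map fst u' = u" "map fst v' = v" "map fst z' = z"
    by (auto simp: map_eq_append_conv map_eq_Cons_conv append_eq_map_conv Cons_eq_map_conv)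
  have "\<exists>w'. wstep w w' \<and> map fst w' = u @ s # map (exchange s t) (rev v) @ t # z"
  proof (cases "s = t")
    case same: True
    show ?thesis
    proof (cases "b = c")
      case True
      then show ?thesis using same w m wstep.O1[of u' "(s, b)" v' z'] by (force simp: rev_map)
    next
      case False
      obtain t' where "t \<noteq> t'" by (metis ty.distinct(1))
      then show ?thesis using same w m wstep.O22[OF False, of t t' u' v' z']
        by (force simp: rev_map comp_def fst_act)
    qed
  next
    case False
    then show ?thesis using w m wstep.O32[of "(s, b)" "(t, c)" u' v' z']
      by (force simp: rev_map comp_def fst_swap)
  qed
  then show "\<exists>w'. wstep\<^sup>*\<^sup>* w w' \<and> map fst w' = u @ s # map (exchange s t) (rev v) @ t # z"
    by blast
qed

section \<open>Reducing to a single letter of type C\<close>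

text \<open>Reflect the block from \<open>t\<close> to \<open>r\<close>. If \<open>t\<close> and
  \<open>s\<close> differ, then \<open>r = t\<close>, since only two types other than
  \<open>C\<close> exist.\<close>

lemma reaches_shift:
  assumes "t \<noteq> C" "s \<noteq> C" "r \<noteq> C" "s \<noteq> r"
  shows "reaches (u @ t # C # s # r # z) (u @ t # (if t = s then r else s) # C # r # z)"
proof (cases "t = s")
  case True
  then show ?thesis using reaches_block[of u t "[C, s]" r z] assms by simp
next
  case False
  then have "r = t" using assms by (cases t; cases s; cases r) auto
  then show ?thesis using False reaches_block[of u t "[C, s]" t z] assms by simp
qed

text \<open>Reflecting the block with ends \<open>t\<close> and \<open>C\<close> turns its inner
  \<open>C\<close> into \<open>t\<close>.\<close>

lemma reaches_merge:
  assumes "t \<noteq> C" "s \<noteq> C" "s \<noteq> t"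
  shows "reaches (u @ t # C # s # C # z) (u @ t # s # t # C # z)"
  using reaches_block[of u t "[C, s]" C z] assms by simp

text \<open>The first \<open>C\<close> is shifted through the gap \<open>g\<close> until one letter
  is left, and then merged. The left neighbour changes at each shift, hence the induction over
  arbitrary \<open>t\<close>. A gap \<open>[t]\<close> is excluded since reflecting
  \<open>t C t C\<close> changes nothing. That \<open>A\<close> and \<open>B\<close> both occur in
  the result keeps the removal repeatable.\<close>

lemma reaches_remove:
  assumes "t \<noteq> C" "C \<notin> set g" "g \<noteq> []" "g \<noteq> [t]" "successively (\<noteq>) g"
  shows "\<exists>h. C \<notin> set h \<and> {A, B} \<subseteq> set (t # h) \<and>
    (\<forall>u z. reaches (u @ t # C # g @ C # z) (u @ t # h @ C # z))"
  using assms
proof (induction g arbitrary: t rule: induct_list012)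
  case 1
  then show ?case by simp
next
  case (2 s)
  have "{A, B} \<subseteq> set (t # [s, t])" using 2 by (cases s; cases t) auto
  then show ?case using 2 reaches_merge[of t s] by (intro exI[of _ "[s, t]"]) auto
next
  case (3 s r g)
  note C_free = \<open>C \<notin> set (s # r # g)\<close> and ne = \<open>successively (\<noteq>) (s # r # g)\<close>
  \<comment> \<open>The new left neighbour of \<open>C\<close> after one shift. It differs from
    \<open>t\<close>, so \<open>A\<close> and \<open>B\<close> already both occur among these
    two.\<close>
  define s' where "s' = (if t = s then r else s)"
  have s': "s' \<noteq> C" "s' \<noteq> t" using C_free ne by (auto simp: s'_def)
  have shift: "reaches (u @ t # C # s # r # g @ C # z) (u @ t # s' # C # r # g @ C # z)" for u z
    using reaches_shift[of t s r u "g @ C # z"] C_free ne \<open>t \<noteq> C\<close>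
    unfolding s'_def append_Cons by auto
  show ?case
  proof (cases "r # g = [s']")
    case False
    then obtain h where h: "C \<notin> set h" "{A, B} \<subseteq> set (s' # h)"
        "\<And>u z. reaches (u @ s' # C # (r # g) @ C # z) (u @ s' # h @ C # z)"
      using "3.IH"(2)[of s'] s' C_free ne by auto
    have "reaches (u @ t # C # (s # r # g) @ C # z) (u @ t # (s' # h) @ C # z)" for u z
      using reaches_trans[OF shift[of u z]] h(3)[of "u @ [t]" z] by simp
    then show ?thesis using h s' by (intro exI[of _ "s' # h"]) auto
  next
    case True
    \<comment> \<open>The shift would lead to the stuck pattern. This forces the gap
      \<open>[t, r]\<close>; reflecting between the two letters \<open>C\<close> first reverses it
      to \<open>[r, t]\<close>, after which shifting and merging succeed.\<close>
    then have ts: "t = s" "g = []" using ne by (auto simp: s'_def split: if_splits)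
    have "reaches (u @ t # C # (s # r # g) @ C # z) (u @ t # [r, t, r] @ C # z)" for u z
    proof -
      have "reaches (u @ t # C # t # r # C # z) (u @ t # C # r # t # C # z)"
        using reaches_block[of "u @ [t]" C "[t, r]" C z] by simp
      also have "reaches (u @ t # C # r # t # C # z) (u @ t # r # C # t # C # z)"
        using reaches_shift[of t r t u "C # z"] C_free ne ts by auto
      also have "reaches (u @ t # r # C # t # C # z) (u @ t # r # t # r # C # z)"
        using reaches_merge[of r t "u @ [t]" z] C_free ne ts by auto
      finally show ?thesis using ts by simp
    qed
    moreover have "{A, B} \<subseteq> set (t # [r, t, r])"
      using ts C_free ne by (cases s; cases r) auto
    ultimately show ?thesis
      using ts C_free by (intro exI[of _ "[r, t, r]"]) auto
  qed
qed

text \<open>Scan the gaps from the left: while they equal \<open>[t]\<close>, the next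
  \<open>C\<close> is again preceded by \<open>t\<close>. The letter \<open>y\<close> forces a
  different gap eventually, and \<open>last z = C\<close> ensures that this gap is closed by a
  \<open>C\<close>.\<close>

lemma exists_removable:
  assumes "successively (\<noteq>) (t # C # z)" "t \<noteq> C" "last z = C" "y \<in> set z" "y \<noteq> t" "y \<noteq> C"
  shows "\<exists>u t' g z'. t # C # z = u @ t' # C # g @ C # z' \<and> t' \<noteq> C \<and> C \<notin> set g \<and>
    g \<noteq> [] \<and> g \<noteq> [t'] \<and> successively (\<noteq>) g"
  using assms
proof (induction "length z" arbitrary: z rule: less_induct)
  case less
  have "C \<in> set z" using less.prems(3,4) by (metis last_in_set list.set(1) empty_iff)
  then obtain g z' where z: "z = g @ C # z'" "C \<notin> set g"
    by (meson split_list_first)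
  have g: "g \<noteq> []" "successively (\<noteq>) g"
    using less.prems(1) z by (auto simp: successively_Cons successively_append_iff)
  show ?case
  proof (cases "g = [t]")
    case False
    then show ?thesis using z g less.prems(2) by (intro exI[of _ "[]"]) auto
  next
    case True
    have "y \<in> set z'" using less.prems z True by auto
    moreover have "last z' = C" using less.prems(3) z \<open>y \<in> set z'\<close> by (cases z') auto
    ultimately obtain u t' h z'' where "t # C # z' = u @ t' # C # h @ C # z''" "t' \<noteq> C" "C \<notin> set h"
      "h \<noteq> []" "h \<noteq> [t']" "successively (\<noteq>) h"
      using less.hyps[of z'] less.prems z True by (auto simp: successively_Cons)
    then show ?thesis using z True by (intro exI[of _ "[t, C] @ u"]) auto
  qed
qed

text \<open>Rotate so that the word starts with some \<open>t\<close> other than \<open>C\<close>,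
  followed by \<open>C\<close>. Either the next gap is removable at once, or it is
  \<open>[t]\<close> and a later gap is removable.\<close>

lemma reaches_fewer_C:
  assumes "proper ts" "{A, B} \<subseteq> set ts" "count_list ts C \<ge> 2"
  shows "\<exists>ts'. reaches ts ts' \<and> {A, B} \<subseteq> set ts' \<and> C \<in> set ts' \<and> count_list ts' C < count_list ts C"
proof -
  have remove: ?thesis if ts: "reaches ts (u @ t # C # g @ C # z)" "t \<noteq> C" "C \<notin> set g" "g \<noteq> []"
    "g \<noteq> [t]" "successively (\<noteq>) g" "count_list (u @ z) C + 2 = count_list ts C" for u t g z
  proof -
    obtain h where h: "C \<notin> set h" "{A, B} \<subseteq> set (t # h)"
        "reaches (u @ t # C # g @ C # z) (u @ t # h @ C # z)"
      using reaches_remove ts by metis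
    then have "reaches ts (u @ t # h @ C # z)" using ts(1) reaches_trans by blast
    then show ?thesis using h ts(2,7) by (intro exI[of _ "u @ t # h @ C # z"]) auto
  qed
  have "C \<in> set ts" using assms(3) by (metis count_list_0_iff not_numeral_le_zero)
  then obtain u v where "ts = u @ C # v" by (meson split_list)
  define xs where "xs = v @ u"
  have 1: "reaches ts (C # xs)" "proper (C # xs)" "count_list ts C = Suc (count_list xs C)"
      "set ts = insert C (set xs)"
    using reaches_rotate[of u "C # v"] proper_rotate[of u "C # v"] assms(1)
    by (auto simp: \<open>ts = _\<close> xs_def)
  have "xs \<noteq> []" using 1(3) assms(3) by auto
  then obtain ys t where xs: "xs = ys @ [t]" by (metis rev_exhaust)
  have "t \<noteq> C"
    using 1(2) successively_join[of "(\<noteq>)" "C # ys" t "[C]"] by (simp add: proper_def xs)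
  then have "C \<in> set ys" using 1(3) assms(3) xs by (cases "C \<in> set ys") (auto simp: count_list_0_iff)
  then obtain g z where ys: "ys = g @ C # z" "C \<notin> set g" by (meson split_list_first)
  have rot: "reaches ts (t # C # g @ C # z)"
    using reaches_trans[OF 1(1)] reaches_rotate[of "C # g @ C # z" "[t]"] by (simp add: xs ys)
  have g: "g \<noteq> []" "successively (\<noteq>) g"
    using 1(2) by (auto simp: proper_def xs ys successively_append_iff successively_Cons)
  show ?thesis
  proof (cases "g = [t]")
    case False
    then show ?thesis using remove[of "[]" t g z] rot ys g 1(3) xs \<open>t \<noteq> C\<close> by simp
  next
    case True
    \<comment> \<open>Moving the leading \<open>t C\<close> to the back makes the word end in
      \<open>C\<close>, as \<open>exists_removable\<close> requires.\<close>
    have rot': "reaches ts (t # C # z @ [t, C])"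
      using reaches_trans[OF rot] reaches_rotate[of "[t, C]" "t # C # z"] True by simp
    obtain y where y: "y \<in> {A, B}" "y \<noteq> t" by (cases t) auto
    then have "y \<in> set z" "y \<noteq> C" using assms(2) 1(4) xs ys True \<open>t \<noteq> C\<close> by auto
    moreover have "successively (\<noteq>) (t # C # z @ [t, C])"
      using 1(2) \<open>t \<noteq> C\<close>
      by (auto simp: proper_def xs ys True successively_append_iff successively_Cons)
    ultimately obtain u t' h z' where eq: "t # C # z @ [t, C] = u @ t' # C # h @ C # z'"
      and removable: "t' \<noteq> C" "C \<notin> set h" "h \<noteq> []" "h \<noteq> [t']" "successively (\<noteq>) h"
      using exists_removable[of t "z @ [t, C]" y] y \<open>t \<noteq> C\<close> by auto
    have "count_list (u @ t' # C # h @ C # z') C = count_list (t # C # z @ [t, C]) C"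
      by (simp only: eq)
    then have "count_list (u @ z') C + 2 = count_list ts C"
      using 1(3) xs ys True \<open>t \<noteq> C\<close> removable(1,2) by (simp add: count_list_0_iff)
    then show ?thesis using remove[of u t' h z'] rot' removable unfolding eq by blast
  qed
qed

section \<open>Removing all but one letter of type C\<close>

lemma wsteps_length: "wstep\<^sup>*\<^sup>* w w' \<Longrightarrow> length w' = length w"
  by (induction rule: rtranclp_induct) (auto dest: wstep_length)

lemma wsteps_proper: "wstep\<^sup>*\<^sup>* w w' \<Longrightarrow> proper (map fst w) \<Longrightarrow> proper (map fst w')"
  by (induction rule: rtranclp_induct) (auto dest: wstep_proper)

lemma wsteps_flat: "wstep\<^sup>*\<^sup>* w w' \<Longrightarrow> flat w' \<Longrightarrow> flat w"
  by (induction rule: rtranclp_induct) (auto dest: wstep_flat)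

lemma wsteps_single_C:
  assumes "proper (map fst w)" "{A, B, C} \<subseteq> fst ` set w"
  shows "\<exists>c v. wstep\<^sup>*\<^sup>* w ((C, c) # v) \<and> C \<notin> fst ` set v"
  using assms
proof (induction "count_list (map fst w) C" arbitrary: w rule: less_induct)
  case less
  show ?case
  proof (cases "count_list (map fst w) C \<ge> 2")
    case True
    then obtain ts where ts: "reaches (map fst w) ts" "{A, B} \<subseteq> set ts" "C \<in> set ts"
        "count_list ts C < count_list (map fst w) C"
      using reaches_fewer_C[of "map fst w"] less.prems by auto
    then obtain w' where w': "wstep\<^sup>*\<^sup>* w w'" "map fst w' = ts" by (auto simp: reaches_def)
    then have "proper (map fst w')" "{A, B, C} \<subseteq> fst ` set w'"
      using wsteps_proper less.prems ts by (auto simp flip: set_map)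
    then show ?thesis using less.hyps[of w'] w' ts(4) by (metis rtranclp_trans)
  next
    case False
    obtain c where "(C, c) \<in> set w" using less.prems(2) by auto
    then obtain u v where w: "w = u @ (C, c) # v" by (meson split_list)
    then have "count_list (map fst (v @ u)) C = 0" using False by simp
    then have "C \<notin> fst ` set (v @ u)" by (metis count_list_0_iff set_map)
    moreover have "wstep\<^sup>*\<^sup>* w ((C, c) # v @ u)"
      using wstep.rot[of u "(C, c) # v"] w by auto
    ultimately show ?thesis by blast
  qed
qed

section \<open>Flipping bars\<close>

fun zig :: "ty \<Rightarrow> ty \<Rightarrow> bool list \<Rightarrow> letter list" where
  "zig s t [] = []"
| "zig s t (b # bs) = (s, b) # zig t s bs"

text \<open>The effect of \<open>O21\<close> on the bars of an alternating word: letters two or four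
  places apart have the same type, and if their bars differ, the letters of the other type between
  them change bars.\<close>

inductive flip :: "bool list \<Rightarrow> bool list \<Rightarrow> bool" where
  flip3: "x \<noteq> y \<Longrightarrow> flip (p @ [x, b, y] @ q) (p @ [x, \<not> b, y] @ q)"
| flip5: "x \<noteq> y \<Longrightarrow> flip (p @ [x, a, b, c, y] @ q) (p @ [x, \<not> a, b, \<not> c, y] @ q)"

text \<open>Entries two places apart agree, so in an alternating word each of the two types has a
  constant bar.\<close>

fun const_bars :: "bool list \<Rightarrow> bool" where
  "const_bars (x # y # z # bs) \<longleftrightarrow> x = z \<and> const_bars (y # z # bs)"
| "const_bars _ \<longleftrightarrow> True"

lemma zig_append:
  "zig s t (p @ q) = zig s t p @ (if even (length p) then zig s t q else zig t s q)"
  by (induction p arbitrary: s t) auto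

lemma wstep_zig3:
  "s \<noteq> t \<Longrightarrow> x \<noteq> y \<Longrightarrow> wstep (u @ zig s t ([x, b, y] @ q) @ z) (u @ zig s t ([x, \<not> b, y] @ q) @ z)"
  using wstep.O21[of x y u s "[(t, b)]" "zig t s q @ z"] by simp

lemma wstep_zig5:
  "s \<noteq> t \<Longrightarrow> x \<noteq> y \<Longrightarrow>
    wstep (u @ zig s t ([x, a, b, c, y] @ q) @ z) (u @ zig s t ([x, \<not> a, b, \<not> c, y] @ q) @ z)"
  using wstep.O21[of x y u s "[(t, a), (s, b), (t, c)]" "zig t s q @ z"] by simp

lemma wstep_flip:
  assumes "flip bs bs'" "s \<noteq> t"
  shows "wstep (u @ zig s t bs @ z) (u @ zig s t bs' @ z)"
  using assms
proof cases
  case (flip3 x y p b q)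
  show ?thesis
  \<comment> \<open>The parity of the position decides whether the ends of the block have type
    \<open>s\<close> or \<open>t\<close>.\<close>
  proof (cases "even (length p)")
    case True
    then show ?thesis unfolding flip3 zig_append[of s t p] 
      using wstep_zig3[of s t x y "u @ zig s t p" b q z] assms(2) flip3(3) by auto
  next
    case False
    then show ?thesis unfolding flip3 zig_append[of s t p] 
      using wstep_zig3[of t s x y "u @ zig s t p" b q z] assms(2) flip3(3) by auto
  qed
next
  case (flip5 x y p a b c q)
  show ?thesis
  proof (cases "even (length p)")
    case True
    then show ?thesis unfolding flip5 zig_append[of s t p]
      using wstep_zig5[of s t x y "u @ zig s t p" a b c q z] assms(2) flip5(3) by auto
  next
    case False
    then show ?thesis unfolding flip5 zig_append[of s t p]
      using wstep_zig5[of t s x y "u @ zig s t p" a b c q z] assms(2) flip5(3) by auto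
  qed
qed

lemma wsteps_flips:
  assumes "flip\<^sup>*\<^sup>* bs bs'" "s \<noteq> t"
  shows "wstep\<^sup>*\<^sup>* (u @ zig s t bs @ z) (u @ zig s t bs' @ z)"
  using assms(1)
proof (induction rule: rtranclp_induct)
  case (step cs ds)
  then show ?case using wstep_flip[OF step(2) assms(2), of u z] by simp
qed simp

lemma flip_sym: "flip bs bs' \<Longrightarrow> flip bs' bs"
proof (induction rule: flip.induct)
  case (flip3 x y p b q)
  then show ?case using flip.flip3[of x y p "\<not> b" q] by simp
next
  case (flip5 x y p a b c q)
  then show ?case using flip.flip5[of x y p "\<not> a" b "\<not> c" q] by simp
qed

lemma flips_sym: "flip\<^sup>*\<^sup>* bs bs' \<Longrightarrow> flip\<^sup>*\<^sup>* bs' bs"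
  by (induction rule: rtranclp_induct) (auto intro: converse_rtranclp_into_rtranclp flip_sym)

lemma flip_Cons: "flip bs bs' \<Longrightarrow> flip (x # bs) (x # bs')"
  by (induction rule: flip.induct) (metis append_Cons flip3, metis append_Cons flip5)

lemma flips_Cons: "flip\<^sup>*\<^sup>* bs bs' \<Longrightarrow> flip\<^sup>*\<^sup>* (x # bs) (x # bs')"
  by (induction rule: rtranclp_induct) (auto intro: rtranclp.rtrancl_into_rtrancl flip_Cons)

section \<open>Connectedness of the bar lists under flips\<close>

lemma flips3: "x \<noteq> z \<Longrightarrow> flip\<^sup>*\<^sup>* (x # b # z # q) (x # b' # z # q)"
  using flip3[of x z "[]" b q] by (cases "b = b'") (auto intro: r_into_rtranclp)

text \<open>In the target both triples have different ends. Non-constancy means that one of the two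
  middle entries is already correct, and this lets the other one be set.\<close>

lemma flips_length4:
  assumes "\<not> const_bars [x, q, p, y]"
  shows "flip\<^sup>*\<^sup>* [x, q, p, y] [x, \<not> y, \<not> x, y]"
proof (cases "p = x")
  case True
  then have "q \<noteq> y" using assms by auto
  then show ?thesis using flips_Cons[OF flips3[of q y p "[]" "\<not> x"], of x] by simp
next
  case False
  then show ?thesis using flips3[of x p q "[y]" "\<not> y"] by auto
qed

text \<open>For equal ends, the middle entry can be made \<open>\<not> x\<close>, after which
  \<open>a\<close> and \<open>c\<close> are free. For different ends, \<open>b\<close> is made
  \<open>x\<close>; then only \<open>c\<close> is directly free, and \<open>flip5\<close> changes
  \<open>a\<close> and \<open>c\<close> together.\<close>

lemma flips_length5:
  assumes "\<not> const_bars [x, a, b, c, y]"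
  shows "flip\<^sup>*\<^sup>* [x, a, b, c, y] [x, False, x \<noteq> (x = y), x \<noteq> y, y]"
proof (cases "x = y")
  case True
  have *: "flip\<^sup>*\<^sup>* [x, a, \<not> x, c, x] [x, False, \<not> x, False, x]" for a c
    using flips3[of x "\<not> x" a "[c, x]" False]
      flips_Cons[OF flips_Cons[OF flips3[of "\<not> x" x c "[]" False]], of x False]
    by auto
  show ?thesis
  proof (cases "b = x")
    case b: True
    then have "a \<noteq> c" using assms True by auto
    then have "flip\<^sup>*\<^sup>* [x, a, b, c, x] [x, a, \<not> x, c, x]"
      using flips_Cons[OF flips3[of a c b "[x]"], of x] by simp
    then show ?thesis using * True by (auto intro: rtranclp_trans)
  next
    case False
    then have "b = (\<not> x)" by simp
    then show ?thesis using * True by auto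
  qed
next
  case False
  then have y: "y = (\<not> x)" by simp
  have *: "flip\<^sup>*\<^sup>* [x, a, x, c, \<not> x] [x, False, x, True, \<not> x]" for a c
  proof -
    have "flip\<^sup>*\<^sup>* [x, a, x, c, \<not> x] [x, a, x, \<not> a, \<not> x]"
      using flips_Cons[OF flips_Cons[OF flips3[of x "\<not> x" c "[]"]]] by simp
    also have "flip\<^sup>*\<^sup>* [x, a, x, \<not> a, \<not> x] [x, False, x, True, \<not> x]"
      using flip5[of x "\<not> x" "[]" True x False "[]"] by (cases a) auto
    finally show ?thesis .
  qed
  have "flip\<^sup>*\<^sup>* [x, a, \<not> x, c, \<not> x] [x, \<not> c, \<not> x, c, \<not> x]"
    using flips3[of x "\<not> x" a "[c, \<not> x]"] by simp
  also have "flip\<^sup>*\<^sup>* \<dots> [x, \<not> c, x, c, \<not> x]"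
    using flips_Cons[OF flips3[of "\<not> c" c "\<not> x" "[\<not> x]"]] by simp
  also note *[of "\<not> c" c]
  finally have "flip\<^sup>*\<^sup>* [x, a, \<not> x, c, \<not> x] [x, False, x, True, \<not> x]" .
  then show ?thesis using *[of a c] y by (cases "b = x") auto
qed

text \<open>Flips are reversible, so it suffices that all non-constant lists of length
  \<open>n\<close> with given ends reach a common list; this is \<open>P n\<close>. In the induction
  step the head stays and the tail is normalized.\<close>

lemma flips_connected:
  assumes "\<not> const_bars bs" "\<not> const_bars bs'" "length bs = length bs'" "length bs \<ge> 4"
    "hd bs = hd bs'" "last bs = last bs'"
  shows "flip\<^sup>*\<^sup>* bs bs'"
proof -
  define P where "P n \<longleftrightarrow> (\<forall>x y. \<exists>N. \<forall>bs. length bs = n \<and> \<not> const_bars bs \<and> hd bs = x \<and> last bs = y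
    \<longrightarrow> flip\<^sup>*\<^sup>* bs N)" for n
  have P_I: "P n" if "\<And>bs. length bs = n \<Longrightarrow> \<not> const_bars bs \<Longrightarrow> flip\<^sup>*\<^sup>* bs (N (hd bs) (last bs))"
    for n N
    unfolding P_def
  proof
    fix x show "\<forall>y. \<exists>N. \<forall>bs. length bs = n \<and> \<not> const_bars bs \<and> hd bs = x \<and> last bs = y
      \<longrightarrow> flip\<^sup>*\<^sup>* bs N"
    proof
      fix y show "\<exists>N. \<forall>bs. length bs = n \<and> \<not> const_bars bs \<and> hd bs = x \<and> last bs = y
        \<longrightarrow> flip\<^sup>*\<^sup>* bs N"
        using that by (intro exI[of _ "N x y"]) auto
    qed
  qed
  have "P n" if "n \<ge> 4" for n
    using that
  proof (induction n rule: less_induct)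
    case (less n)
    \<comment> \<open>The list \<open>K\<close> of length \<open>n - 2\<close> used in the step
      needs four entries, so 4 and 5 are both base cases.\<close>
    consider "n = 4" | "n = 5" | "n \<ge> 6" using less.prems by linarith
    then show ?case
    proof cases
      case 1
      have "flip\<^sup>*\<^sup>* bs [hd bs, \<not> last bs, \<not> hd bs, last bs]"
        if "length bs = 4" "\<not> const_bars bs" for bs
      proof -
        have "length bs = Suc (Suc (Suc (Suc 0)))" using that(1) by simp
        then obtain x q p y where "bs = [x, q, p, y]" by (auto simp: length_Suc_conv)
        then show ?thesis using flips_length4 that(2) by simp
      qed
      then show ?thesis unfolding 1 by (rule P_I)
    next
      case 2
      have "flip\<^sup>*\<^sup>* bs [hd bs, False, hd bs \<noteq> (hd bs = last bs), hd bs \<noteq> last bs, last bs]"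
        if "length bs = 5" "\<not> const_bars bs" for bs
      proof -
        have "length bs = Suc (Suc (Suc (Suc (Suc 0))))" using that(1) by simp
        then obtain x a b c y where "bs = [x, a, b, c, y]" by (auto simp: length_Suc_conv)
        then show ?thesis using flips_length5[of x a b c y] that(2) by simp
      qed
      then show ?thesis unfolding 2 by (rule P_I)
    next
      case 3
      have "\<exists>N. \<forall>bs. length bs = n \<and> \<not> const_bars bs \<and> hd bs = x \<and> last bs = y
        \<longrightarrow> flip\<^sup>*\<^sup>* bs N" for x y
      proof -
        \<comment> \<open>The first and third entries of \<open>K\<close> differ, so \<open>u # K\<close> is non-constant for both \<open>u\<close>, and
          after \<open>x\<close> the entry \<open>u\<close> can be flipped because \<open>K\<close> starts with \<open>\<not> x\<close>.\<close>
        define K where "K = [\<not> x, False, x] @ replicate (n - 6) False @ [y]"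
        have K: "length K = n - 2" "last K = y" "\<not> const_bars (u # K)" for u
          using 3 by (auto simp: K_def)
        have main: "flip\<^sup>*\<^sup>* (x # u # bs) (x # False # K)"
          if "length bs = n - 2" "last bs = y" "\<not> const_bars (u # bs)" for u bs
        proof -
          have "P (n - 1)" using less.IH[of "n - 1"] 3 by simp
          then have "\<exists>N. \<forall>bs. length bs = n - 1 \<and> \<not> const_bars bs \<and> hd bs = u \<and> last bs = y
              \<longrightarrow> flip\<^sup>*\<^sup>* bs N"
            unfolding P_def by (elim allE)
          then obtain N where N: "\<forall>bs. length bs = n - 1 \<and> \<not> const_bars bs \<and> hd bs = u \<and> last bs = y
              \<longrightarrow> flip\<^sup>*\<^sup>* bs N" by blast
          have "bs \<noteq> []" using that(1) 3 by auto
          then have "flip\<^sup>*\<^sup>* (u # bs) N" "flip\<^sup>*\<^sup>* (u # K) N"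
            using N that K 3 by (auto simp: K_def)
          then have "flip\<^sup>*\<^sup>* (u # bs) (u # K)" by (meson flips_sym rtranclp_trans)
          then have "flip\<^sup>*\<^sup>* (x # u # bs) (x # u # K)" by (rule flips_Cons)
          also have "flip\<^sup>*\<^sup>* (x # u # K) (x # False # K)"
            unfolding K_def using flips3[of x "\<not> x" u _ False] by simp
          finally show ?thesis .
        qed
        have "flip\<^sup>*\<^sup>* bs (x # False # K)"
          if bs: "length bs = n" "\<not> const_bars bs" "hd bs = x" "last bs = y" for bs
        proof -
          have "length bs = Suc (Suc (Suc (Suc (n - 4))))" using bs(1) 3 by simp
          then obtain u p q cs where eq: "bs = x # u # p # q # cs"
            using bs(3) by (auto simp: length_Suc_conv)
          show ?thesis
          proof (cases "const_bars (u # p # q # cs)")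
            case False
            then show ?thesis using main[of "p # q # cs" u] bs eq by auto
          next
            case True
            \<comment> \<open>Only the head breaks constancy here, so \<open>u\<close> can be
              flipped, and then \<open>u\<close> and \<open>q\<close> differ and the tail is no
              longer constant.\<close>
            then have "x \<noteq> p" "\<not> const_bars ((\<not> u) # p # q # cs)" using bs eq by auto
            then show ?thesis
              using flips3[of x p u "q # cs" "\<not> u"] main[of "p # q # cs" "\<not> u"] bs eq
              by (auto intro: rtranclp_trans)
          qed
        qed
        then show ?thesis by blast
      qed
      then show ?thesis unfolding P_def by blast
    qed
  qed
  then obtain N where "\<And>cs. length cs = length bs \<Longrightarrow> \<not> const_bars cs \<Longrightarrow> hd cs = hd bs \<Longrightarrow>
      last cs = last bs \<Longrightarrow> flip\<^sup>*\<^sup>* cs N"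
    using assms(4) unfolding P_def by metis
  then have "flip\<^sup>*\<^sup>* bs N" "flip\<^sup>*\<^sup>* bs' N" using assms by auto
  then show ?thesis by (meson flips_sym rtranclp_trans)
qed

section \<open>Canonical words\<close>

text \<open>Without \<open>C\<close>, a letter that differs in type from its predecessor has only
  one possible type, so first type and bars determine the word.\<close>

lemma zig_map_snd:
  assumes "successively (\<noteq>) (map fst v)" "C \<notin> fst ` set v" "{s, t} = {A, B}"
    "v = [] \<or> fst (hd v) = s"
  shows "zig s t (map snd v) = v"
  using assms
proof (induction v arbitrary: s t)
  case (Cons x v)
  have "v = [] \<or> fst (hd v) = t"
  proof (cases v)
    case (Cons y v')
    then have "fst y \<noteq> s" "fst y \<noteq> C" using Cons.prems by auto
    then show ?thesis using Cons \<open>{s, t} = {A, B}\<close> by (cases "fst y") (auto simp: doubleton_eq_iff)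
  qed simp
  moreover have "successively (\<noteq>) (map fst v)" using Cons.prems(1) by (cases v) auto
  ultimately have "zig t s (map snd v) = v"
    using Cons.IH[of t s] Cons.prems by (auto simp: insert_commute)
  then show ?case using Cons.prems(4) by (cases x) auto
qed simp

section \<open>Effect of linear maps on the bars of an alternating word\<close>

fun alt_xor :: "bool \<Rightarrow> bool \<Rightarrow> bool list \<Rightarrow> bool list" where
  "alt_xor a b [] = []"
| "alt_xor a b (x # bs) = (x \<noteq> a) # alt_xor b a bs"

lemma map_act_zig: "map (act p f) (zig s t bs) = zig (p s) (p t) (alt_xor (f s) (f t) bs)"
  by (induction bs arbitrary: s t) auto

lemma length_alt_xor [simp]: "length (alt_xor a b bs) = length bs"
  by (induction bs arbitrary: a b) auto

lemma const_bars_alt_xor: "const_bars (alt_xor a b bs) \<longleftrightarrow> const_bars bs"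
  by (induction bs arbitrary: a b rule: const_bars.induct) auto

lemma hd_alt_xor: "bs \<noteq> [] \<Longrightarrow> hd (alt_xor a b bs) = (hd bs \<noteq> a)"
  by (cases bs) auto

lemma last_alt_xor:
  "bs \<noteq> [] \<Longrightarrow> last (alt_xor a b bs) = (last bs \<noteq> (if odd (length bs) then a else b))"
proof (induction bs arbitrary: a b)
  case (Cons x bs)
  then show ?case by (cases bs) auto
qed simp

lemma const_bars_alt_xor_eq:
  "const_bars (x # y # bs) \<Longrightarrow> alt_xor x y (x # y # bs) = replicate (length bs + 2) False"
proof (induction bs arbitrary: x y)
  case (Cons z bs)
  then show ?case by (cases bs) auto
qed simp

lemma snd_zig: "x \<in> set (zig s t bs) \<Longrightarrow> snd x \<in> set bs"
  by (induction bs arbitrary: s t) auto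

lemma flat_no_bars: "flat ((C, False) # zig A B (replicate n False))"
  unfolding flat_def
  by (rule exI[of _ "\<lambda>_. False"]) (auto simp: additive_def dest: snd_zig)

lemma wstep_signs:
  "additive f \<Longrightarrow>
    wstep ((C, c) # zig A B bs) ((C, c \<noteq> f C) # zig A B (alt_xor (f A) (f B) bs))"
  using wstep.act[of id f "(C, c) # zig A B bs"] by (simp add: map_act_zig)

lemma wsteps_zig:
  assumes "proper (map fst w)" "{A, B, C} \<subseteq> fst ` set w"
  shows "\<exists>c bs. wstep\<^sup>*\<^sup>* w ((C, c) # zig A B bs)"
proof -
  obtain c v where v: "wstep\<^sup>*\<^sup>* w ((C, c) # v)" "C \<notin> fst ` set v"
    using wsteps_single_C assms by blast
  have "proper (map fst ((C, c) # v))" using wsteps_proper v assms by blast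
  then have ne: "successively (\<noteq>) (map fst v)"
    using successively_append_iff[of "(\<noteq>)" "C # map fst v" "[C]"]
    by (cases v) (auto simp: proper_def)
  show ?thesis
  proof (cases "v = [] \<or> fst (hd v) = A")
    case True
    then have "zig A B (map snd v) = v" using zig_map_snd ne v(2) by blast
    then show ?thesis using v(1) by metis
  next
    case False
    then have "fst (hd v) = B" using v(2) by (cases v; cases "fst (hd v)") auto
    then have "zig B A (map snd v) = v" using zig_map_snd[of v B A] ne v(2) by blast
    \<comment> \<open>A word starting with \<open>B\<close> is renamed by exchanging
      \<open>A\<close> and \<open>B\<close>; \<open>alt_xor False False\<close> leaves the bars
      alone.\<close>
    then have "wstep ((C, c) # v) ((C, c) # zig A B (alt_xor False False (map snd v)))"
      using wstep.act[of "exchange A B" "\<lambda>_. False" "(C, c) # v"]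
        map_act_zig[of "exchange A B" "\<lambda>_. False" B A "map snd v"]
      by (simp add: additive_def inj_exchange)
    then show ?thesis using v(1) by (meson rtranclp.rtrancl_into_rtrancl)
  qed
qed

text \<open>Constant bars are removed by a linear map; otherwise a linear map adjusts the end bars
  and flips do the rest. For even \<open>m\<close> the alternating part starts and ends with
  \<open>A\<close>, and its last letter is rotated to the front.\<close>

lemma wsteps_canonical:
  assumes "proper (map fst w)" "{A, B, C} \<subseteq> fst ` set w" "\<not> flat w" "length w = m" "m > 4"
  shows "if odd m
    then wstep\<^sup>*\<^sup>* w ((C, True) # zig A B (replicate (m - 1) False)) \<or>
      (\<exists>c. wstep\<^sup>*\<^sup>* w ((C, c) # zig A B (True # replicate (m - 2) False)))
    else wstep\<^sup>*\<^sup>* w ((A, False) # (C, True) # zig A B (replicate (m - 2) False)) \<or>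
      (\<exists>d. wstep\<^sup>*\<^sup>* w ((A, d) # (C, False) # zig A B (True # replicate (m - 3) False)))"
proof -
  obtain c bs where w: "wstep\<^sup>*\<^sup>* w ((C, c) # zig A B bs)"
    using wsteps_zig assms(1,2) by blast
  have len: "length (zig s t xs) = length xs" for s t xs by (induction xs arbitrary: s t) auto
  have bs: "length bs = m - 1" using wsteps_length[OF w] len assms(4,5) by simp
  then have "length bs = Suc (Suc (m - 3))" using assms(5) by simp
  then obtain x y cs where xy: "bs = x # y # cs" by (auto simp: length_Suc_conv)
  have signs: "wstep\<^sup>*\<^sup>* w ((C, c \<noteq> f C) # zig A B (alt_xor (f A) (f B) bs))" if "additive f" for f
    using w wstep_signs[OF that] by (meson rtranclp.rtrancl_into_rtrancl)
  \<comment> \<open>The additive functional with prescribed values at \<open>A\<close> and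
    \<open>B\<close>.\<close>
  define sg where "sg a b t = (case t of A \<Rightarrow> a | B \<Rightarrow> b | C \<Rightarrow> a \<noteq> b)" for a b t
  have sg: "additive (sg a b)" "sg a b A = a" "sg a b B = b" "sg a b C = (a \<noteq> b)" for a b
    by (auto simp: sg_def additive_def)
  have rot: "wstep ((C, e) # zig A B (p @ [d])) ((A, d) # (C, e) # zig A B p)"
    if "even (length p)" for e p d
    using that wstep.rot[of "(C, e) # zig A B p" "[(A, d)]"] by (simp add: zig_append)
  show ?thesis
  proof (cases "const_bars bs")
    case True
    then have "alt_xor x y bs = replicate (length bs) False"
      using const_bars_alt_xor_eq[of x y cs] xy by simp
    then have "alt_xor x y bs = replicate (m - 1) False"
      unfolding bs .
    then obtain e where e: "wstep\<^sup>*\<^sup>* w ((C, e) # zig A B (replicate (m - 1) False))"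
      using signs[OF sg(1), of x y] sg by auto
    then have "\<not> flat ((C, e) # zig A B (replicate (m - 1) False))"
      using wsteps_flat assms(3) by blast
    \<comment> \<open>Without the bar on \<open>C\<close> the word would have no bars at all and be
      flat.\<close>
    then have "e" using flat_no_bars[of "m - 1"] by (cases e) auto
    have "wstep\<^sup>*\<^sup>* w ((A, False) # (C, True) # zig A B (replicate (m - 2) False))" if "even m"
    proof -
      have "m - 1 = Suc (m - 2)" using assms(5) by simp
      then have "replicate (m - 1) False = replicate (m - 2) False @ [False]"
        by (simp add: replicate_append_same)
      then have "wstep ((C, e) # zig A B (replicate (m - 1) False))
          ((A, False) # (C, True) # zig A B (replicate (m - 2) False))"
        using rot[of "replicate (m - 2) False" e False] \<open>e\<close> that by simp
      with e show ?thesis by (rule rtranclp.rtrancl_into_rtrancl)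
    qed
    then show ?thesis using e \<open>e\<close> by simp
  next
    case False
    \<comment> \<open>The last letter has type \<open>A\<close> for even \<open>m\<close> and
      \<open>B\<close> for odd \<open>m\<close>. The assumption \<open>m > 4\<close> provides the
      four bars needed by \<open>flips_connected\<close>.\<close>
    have flips: "wstep\<^sup>*\<^sup>* w ((C, c \<noteq> f C) # zig A B cs)"
      if "additive f" "length cs = m - 1" "\<not> const_bars cs" "hd cs = (x \<noteq> f A)"
        "last cs = (last bs \<noteq> (if even m then f A else f B))" for f cs
    proof -
      have "flip\<^sup>*\<^sup>* (alt_xor (f A) (f B) bs) cs"
      proof (rule flips_connected)
        have "bs \<noteq> []" "hd bs = x" "odd (length bs) \<longleftrightarrow> even m" using xy bs assms(5) by auto
        then show "hd (alt_xor (f A) (f B) bs) = hd cs" "last (alt_xor (f A) (f B) bs) = last cs"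
          unfolding that(4,5) by (simp_all add: hd_alt_xor last_alt_xor)
      qed (use that(2,3) False bs assms(5) in \<open>simp_all add: const_bars_alt_xor\<close>)
      then have "wstep\<^sup>*\<^sup>* ((C, c \<noteq> f C) # zig A B (alt_xor (f A) (f B) bs)) ((C, c \<noteq> f C) # zig A B cs)"
        using wsteps_flips[of _ cs A B "[(C, c \<noteq> f C)]" "[]"] by simp
      with signs[OF that(1)] show ?thesis by (rule rtranclp_trans)
    qed
    show ?thesis
    proof (cases "odd m")
      case True
      \<comment> \<open>The ends have types \<open>A\<close> and \<open>B\<close>, so the values
        \<open>\<not> x\<close> and \<open>last bs\<close> of the functional normalize both end
        bars. The bar on \<open>C\<close> is then determined, giving two possible words.\<close>
      have "m - 2 = Suc (Suc (m - 4))" using assms(5) by simp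
      then have "\<not> const_bars (True # replicate (m - 2) False)" "last (True # replicate (m - 2) False) = False"
        by auto
      then have "wstep\<^sup>*\<^sup>* w ((C, c \<noteq> ((\<not> x) \<noteq> last bs)) # zig A B (True # replicate (m - 2) False))"
        using flips[OF sg(1), of "True # replicate (m - 2) False" "\<not> x" "last bs"] True assms(5)
        unfolding sg by simp
      then have "\<exists>c. wstep\<^sup>*\<^sup>* w ((C, c) # zig A B (True # replicate (m - 2) False))"
        by blast
      then show ?thesis using True by simp
    next
      case False
      \<comment> \<open>Both ends have type \<open>A\<close>, so normalizing the first bar
        determines the last one, \<open>d\<close>. The free value at \<open>B\<close> is chosen as
        \<open>c \<noteq> (\<not> x)\<close>, which clears the bar on \<open>C\<close>.\<close>
      define d where "d = (last bs \<noteq> (\<not> x))"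
      let ?p = "True # replicate (m - 3) False"
      have "m - 3 = Suc (Suc (m - 5))" using assms(5) by simp
      then have "\<not> const_bars (?p @ [d])" by auto
      then have "wstep\<^sup>*\<^sup>* w ((C, False) # zig A B (?p @ [d]))"
        using flips[OF sg(1), of "?p @ [d]" "\<not> x" "c \<noteq> (\<not> x)"] False assms(5)
        unfolding sg d_def by (cases c; cases x) simp_all
      moreover have "wstep ((C, False) # zig A B (?p @ [d])) ((A, d) # (C, False) # zig A B ?p)"
        using rot[of ?p False d] False assms(5) by auto
      ultimately have "wstep\<^sup>*\<^sup>* w ((A, d) # (C, False) # zig A B ?p)"
        by (rule rtranclp.rtrancl_into_rtrancl)
      then show ?thesis using False by auto
    qed
  qed
qed

section \<open>From words to colorings\<close>

lemma vec_add_self [simp]: "(x :: vec3) + x = 0"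
  by (simp add: vec_eq_iff)

lemma vec_mult_2 [simp]: "2 * (x :: vec3) = 0"
  by (simp add: mult_2)

lemma vec_minus_eq: "(x :: vec3) - y = x + y"
  using minus_diff_eq by (simp add: vec_eq_iff)

lemma vec_add_eq_0: "(x :: vec3) + y = 0 \<longleftrightarrow> x = y"
  by (metis add_left_cancel vec_add_self)

lemma ex_bit: "(\<exists>k :: bit. P k) \<longleftrightarrow> P 0 \<or> P 1"
  by (metis bit_not_zero_iff)

lemma vec_add_left_self [simp]: "(x :: vec3) + (x + y) = y"
  by (simp flip: add.assoc)

text \<open>The only scalars are 0 and 1.\<close>

lemma span_insert_iff:
  "(v :: vec3) \<in> vec.span (insert a S) \<longleftrightarrow> v \<in> vec.span S \<or> v + a \<in> vec.span S"
  by (simp add: vec.span_breakdown_eq ex_bit vec_minus_eq)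

lemma vec_add_eq_iff: "(x :: vec3) + y = z \<longleftrightarrow> x = z + y"
  by (auto simp: add.assoc)

lemma span_pair: "vec.span {a, b :: vec3} = {0, a, b, a + b}"
  by (auto simp: span_insert_iff vec_add_eq_iff add.commute)

lemma independent3_iff:
  "distinct [a, b, c :: vec3] \<and> vec.independent {a, b, c} \<longleftrightarrow>
    a \<noteq> 0 \<and> b \<noteq> 0 \<and> b \<noteq> a \<and> c \<notin> {0, a, b, a + b}"
proof -
  have eq: "{a, b, c} = insert c (insert b (insert a {}))" by auto
  show ?thesis
    unfolding eq vec.independent_insert
    by (auto simp: span_pair insert_commute[of b a] span_insert_iff vec_add_eq_0 vec.independent_empty)
qed

lemma independent2_iff:
  "a \<noteq> b \<and> vec.independent {a, b :: vec3} \<longleftrightarrow> a \<noteq> 0 \<and> b \<noteq> 0 \<and> b \<noteq> a"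
proof -
  have eq: "{a, b} = insert b (insert a {})" by auto
  show ?thesis
    unfolding eq vec.independent_insert
    by (auto simp: span_insert_iff vec_add_eq_0 vec.independent_empty)
qed

section \<open>Coordinates in a basis, and letters as vectors\<close>

locale basis =
  fixes e1 \<alpha> \<beta> :: vec3
  assumes basis: "basis3 e1 \<alpha> \<beta>"
begin

definition comb :: "bit \<Rightarrow> bit \<Rightarrow> bit \<Rightarrow> vec3" where
  "comb i j k = i *s e1 + j *s \<alpha> + k *s \<beta>"

lemma comb_add: "comb i j k + comb i' j' k' = comb (i + i') (j + j') (k + k')"
  by (simp add: comb_def vec.scale_left_distrib del: add_bit_eq_xor)

lemma comb_eq_0: "comb i j k = 0 \<longleftrightarrow> i = 0 \<and> j = 0 \<and> k = 0"
proof -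
  have "e1 \<noteq> 0" "\<alpha> \<noteq> 0" "\<alpha> \<noteq> e1" "\<beta> \<notin> {0, e1, \<alpha>, e1 + \<alpha>}"
    using basis independent3_iff unfolding basis3_def by blast+
  then show ?thesis
    by (cases i; cases j; cases k) (auto simp: comb_def vec_add_eq_0)
qed

lemma comb_eq_iff: "comb i j k = comb i' j' k' \<longleftrightarrow> i = i' \<and> j = j' \<and> k = k'"
proof -
  have "comb i j k = comb i' j' k' \<longleftrightarrow> comb (i + i') (j + j') (k + k') = 0"
    unfolding comb_add[symmetric] by (simp add: vec_add_eq_0)
  also have "\<dots> \<longleftrightarrow> i = i' \<and> j = j' \<and> k = k'"
    unfolding comb_eq_0 by (cases i; cases i'; cases j; cases j'; cases k; cases k') auto
  finally show ?thesis .
qed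

lemma comb_surj: "\<exists>i j k. v = comb i j k"
proof -
  have "v \<in> vec.span {e1, \<alpha>, \<beta>}" using basis by (simp add: basis3_def)
  then obtain i where "v - i *s e1 \<in> vec.span {\<alpha>, \<beta>}" by (auto simp: vec.span_breakdown_eq)
  then obtain j k where "v - i *s e1 - j *s \<alpha> - k *s \<beta> = 0" by (auto simp: vec.span_breakdown_eq)
  then have "v = comb i j k" by (simp add: comb_def algebra_simps)
  then show ?thesis by blast
qed

fun emb :: "letter \<Rightarrow> vec3" where
  "emb (t, b) = (case t of A \<Rightarrow> \<alpha> | B \<Rightarrow> \<beta> | C \<Rightarrow> \<alpha> + \<beta>) + (if b then e1 else 0)"

declare emb.simps [simp del]

text \<open>The \<alpha>-coordinate vanishes only for type \<open>B\<close>, the \<beta>-coordinate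
  only for type \<open>A\<close>; the bar is the \<open>e1\<close>-coordinate.\<close>

lemma emb_comb: "emb (t, b) = comb (of_bool b) (of_bool (t \<noteq> B)) (of_bool (t \<noteq> A))"
  by (cases t) (auto simp: comb_def emb.simps)

lemma e1_comb: "e1 = comb 1 0 0"
  by (simp add: comb_def)

lemma comb_eq_e1: "comb i j k = e1 \<longleftrightarrow> i = 1 \<and> j = 0 \<and> k = 0"
  by (metis e1_comb comb_eq_iff)

lemma zero_comb: "0 = comb 0 0 0"
  by (simp add: comb_def)

lemmas to_comb = emb_comb zero_comb comb_add

lemma emb_neq_0 [simp]: "emb x \<noteq> 0"
  by (cases x; cases "fst x") (auto simp: emb_comb zero_comb comb_eq_iff)

lemma emb_neq_e1 [simp]: "emb x \<noteq> e1"
  by (cases x; cases "fst x") (auto simp: emb_comb comb_eq_e1)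

lemma emb_eq_iff: "emb x = emb y \<longleftrightarrow> x = y"
  by (cases x; cases y; cases "fst x"; cases "fst y") (auto simp: emb_comb comb_eq_iff)

lemma emb_bar: "emb (t, b) + e1 = emb (t, \<not> b)"
  by (simp add: emb.simps)

lemma vec_cases: "v = 0 \<or> v = e1 \<or> (\<exists>x. v = emb x)"
proof -
  obtain i j k where v: "v = comb i j k" using comb_surj by blast
  have "comb i j k = emb (if k = 0 then A else if j = 0 then B else C, i = 1)" if "j \<noteq> 0 \<or> k \<noteq> 0"
    using that by (cases i; cases j; cases k) (auto simp: emb_comb comb_eq_iff)
  then show ?thesis using v e1_comb zero_comb by (cases i; cases j; cases k) auto
qed

lemma emb_add_neq: "emb x + e1 = emb y \<longleftrightarrow> fst x = fst y \<and> snd x \<noteq> snd y"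
  by (cases x; cases y) (auto simp: emb_bar emb_eq_iff)

text \<open>Dependence means that the two vectors agree up to adding \<open>e1\<close>, that is, up
  to a bar.\<close>

lemma independent_emb_iff:
  "distinct [e1, emb x, emb y] \<and> vec.independent {e1, emb x, emb y} \<longleftrightarrow> fst x \<noteq> fst y"
proof -
  have "e1 \<noteq> 0" by (metis e1_comb comb_eq_0 one_neq_zero)
  then show ?thesis unfolding independent3_iff
    by (auto simp: add.commute[of e1] emb_add_neq emb_eq_iff prod_eq_iff eq_commute[of "emb y"])
qed

text \<open>The map is prescribed on the basis; additivity of \<open>f\<close> makes its value at
  \<open>\<alpha> + \<beta>\<close> the required one. No letter and not \<open>e1\<close> is sent to
  0, so it is injective and thus bijective.\<close>

lemma act_linear:
  assumes "inj p" "additive f"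
  shows "\<exists>\<sigma>. lin \<sigma> \<and> bij \<sigma> \<and> \<sigma> e1 = e1 \<and> (\<forall>x. \<sigma> (emb x) = emb (act p f x))"
proof -
  have ind: "vec.independent {e1, \<alpha>, \<beta>}" and dist: "distinct [e1, \<alpha>, \<beta>]"
    using basis by (auto simp: basis3_def)
  obtain \<sigma> where \<sigma>: "lin \<sigma>" "\<forall>x\<in>{e1, \<alpha>, \<beta>}. \<sigma> x =
      (if x = e1 then e1 else if x = \<alpha> then emb (act p f (A, False)) else emb (act p f (B, False)))"
    using vec.linear_independent_extend[OF ind, of "\<lambda>x. if x = e1 then e1 else
      if x = \<alpha> then emb (act p f (A, False)) else emb (act p f (B, False))"] by blast
  interpret s: Vector_Spaces.linear "(*s)" "(*s)" \<sigma> by (rule \<sigma>(1))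
  have e1: "\<sigma> e1 = e1" and \<alpha>: "\<sigma> \<alpha> = emb (act p f (A, False))" and \<beta>: "\<sigma> \<beta> = emb (act p f (B, False))"
    using \<sigma>(2) dist by auto
  have p: "p A \<noteq> p B" "p A \<noteq> p C" "p B \<noteq> p C" using assms(1) by (auto simp: inj_eq)
  have "\<sigma> \<alpha> + \<sigma> \<beta> = emb (act p f (C, False))" unfolding \<alpha> \<beta>
    using p assms(2) by (cases "p A"; cases "p B"; cases "p C")
      (auto simp: to_comb comb_eq_iff additive_def)
  then have "\<sigma> (emb (t, False)) = emb (act p f (t, False))" for t
    using \<alpha> \<beta> by (cases t) (auto simp: s.add emb.simps[of _ False] simp del: act.simps)
  moreover have "\<sigma> (emb (t, True)) = \<sigma> (emb (t, False)) + e1" for t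
    using e1 emb_bar[of t False] by (metis s.add)
  moreover have "emb (act p f (t, True)) = emb (act p f (t, False)) + e1" for t
    by (simp only: act.simps emb_bar) simp
  ultimately have "\<sigma> (emb (t, b)) = emb (act p f (t, b))" for t b
    by (cases b) (simp_all only: True_implies_equals)
  then have emb: "\<sigma> (emb x) = emb (act p f x)" for x by (cases x) blast
  have "v = 0" if "\<sigma> v = 0" for v
    using vec_cases[of v] that emb e1 basis independent3_iff[of e1 \<alpha> \<beta>] unfolding basis3_def
    by (metis emb_neq_0)
  then have "inj \<sigma>" by (simp add: s.inj_iff_eq_0)
  then have "bij \<sigma>" using vec.linear_inj_imp_surj[OF \<sigma>(1)] by (simp add: bij_def)
  then show ?thesis using \<sigma>(1) e1 emb by blast
qed

lemma basis3_emb: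
  assumes "fst x \<noteq> fst y"
  shows "basis3 e1 (emb x) (emb y)"
proof -
  have 1: "distinct [e1, emb x, emb y]" "vec.independent {e1, emb x, emb y}"
    using assms independent_emb_iff by blast+
  have "card {e1, emb x, emb y} = 3" using 1(1) by simp
  moreover have "vec.dim (UNIV :: vec3 set) = 3" by (simp add: card_cart_basis)
  ultimately have "UNIV \<subseteq> vec.span {e1, emb x, emb y}"
    using 1(2) by (intro vec.card_ge_dim_independent) simp_all
  then show ?thesis using 1 unfolding basis3_def by blast
qed

definition word_coloring :: "letter list \<Rightarrow> facet_coloring" where
  "word_coloring w = Coloring e1 e1 (map emb w)"

end

section \<open>Colorings of the prism as proper words\<close>

lemma proper_iff_nth:
  assumes "ts \<noteq> []"
  shows "proper ts \<longleftrightarrow> (\<forall>i<length ts. ts ! i \<noteq> ts ! (Suc i mod length ts))"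
proof -
  have "(ts @ [hd ts]) ! Suc i = ts ! (Suc i mod length ts)" if "i < length ts" for i
    using that assms by (cases "Suc i = length ts") (auto simp: nth_append hd_conv_nth)
  then show ?thesis
    unfolding proper_def successively_conv_nth by (auto simp: nth_append)
qed

text \<open>Facets with a common point share a vertex, and at a vertex only two neighbouring sides
  and the ceiling or the floor meet. Both heights give the same condition because ceiling and floor
  have one color.\<close>

lemma coloring_iff:
  assumes "m \<ge> 2"
  shows "coloring m (Coloring c c xs) \<longleftrightarrow> length xs = m \<and>
    (\<forall>i<m. distinct [c, xs ! i, xs ! (Suc i mod m)] \<and>
      vec.independent {c, xs ! i, xs ! (Suc i mod m)})"
    (is "?L \<longleftrightarrow> ?R")
proof
  assume L: ?L
  have "distinct [c, xs ! i, xs ! (Suc i mod m)] \<and> vec.independent {c, xs ! i, xs ! (Suc i mod m)}"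
    if "i < m" for i
  proof -
    let ?K = "{Ceil, Side i, Side (Suc i mod m)}"
    have "?K \<subseteq> facets m" using that by (auto simp: facets_def)
    moreover have "(True, Suc i mod m) \<in> (\<Inter>F\<in>?K. facet_verts m F)" using that by auto
    ultimately have "inj_on (col (Coloring c c xs)) ?K \<and> vec.independent (col (Coloring c c xs) ` ?K)"
      using L unfolding coloring_def by blast
    moreover have "i \<noteq> Suc i mod m"
      using that assms by (cases "Suc i = m") auto
    ultimately show ?thesis by (auto simp: inj_on_def)
  qed
  then show ?R using L by (simp add: coloring_def)
next
  assume R: ?R
  have "inj_on (col (Coloring c c xs)) K \<and> vec.independent (col (Coloring c c xs) ` K)"
    if K: "K \<subseteq> facets m" "K \<noteq> {}" "(\<Inter>F\<in>K. facet_verts m F) \<noteq> {}" for K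
  proof -
    obtain t j where tj: "\<And>F. F \<in> K \<Longrightarrow> (t, j) \<in> facet_verts m F" using K(3) by fastforce
    obtain F where "F \<in> K" using K(2) by blast
    then have "j < m" using tj[of F] K(1) assms by (cases F) (auto simp: facets_def)
    \<comment> \<open>The cyclic predecessor of \<open>j\<close>: the vertex \<open>j\<close> lies
      on sides \<open>i\<close> and \<open>j\<close>.\<close>
    define i where "i = (if j = 0 then m - 1 else j - 1)"
    have i: "i < m" "Suc i mod m = j" using \<open>j < m\<close> by (auto simp: i_def)
    let ?B = "if t then Ceil else Floor"
    have "F \<in> {?B, Side i, Side j}" if "F \<in> K" for F
    proof (cases F)
      case (Side k)
      then have "k < m" "k = j \<or> Suc k mod m = j" using tj[OF that] that K(1) by (auto simp: facets_def)
      moreover have "k = i" if "Suc k mod m = j"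
        using that \<open>k < m\<close> \<open>j < m\<close> by (cases "Suc k = m") (auto simp: i_def)
      ultimately show ?thesis using Side by auto
    qed (use tj[OF that] in auto)
    then have sub: "K \<subseteq> {?B, Side i, Side j}" by blast
    have R': "distinct [c, xs ! i, xs ! j]" "vec.independent {c, xs ! i, xs ! j}"
      using R i by blast+
    have "inj_on (col (Coloring c c xs)) {?B, Side i, Side j}"
      using R'(1) by (auto simp: inj_on_def)
    moreover have "col (Coloring c c xs) ` {?B, Side i, Side j} = {c, xs ! i, xs ! j}" by auto
    ultimately show ?thesis
      using sub R'(2) by (metis image_mono inj_on_subset vec.independent_mono)
  qed
  then show ?L using R by (auto simp: coloring_def)
qed

context basis
begin

lemma trivial_word_coloring_iff:
  assumes "m \<ge> 2"
  shows "trivial_coloring m (word_coloring w) \<longleftrightarrow> length w = m \<and> proper (map fst w)"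
proof (cases "length w = m")
  case True
  then have "map fst w \<noteq> []" using assms by auto
  then show ?thesis using True assms
    by (simp add: trivial_coloring_def word_coloring_def coloring_iff proper_iff_nth
        independent_emb_iff del: distinct.simps)
qed (simp add: trivial_coloring_def word_coloring_def coloring_def)

text \<open>A side color is independent of \<open>e1\<close>, hence neither 0 nor \<open>e1\<close>,
  and all other vectors come from letters.\<close>

lemma trivial_coloring_word:
  assumes "trivial_coloring m lam" "ceil_col lam = e1" "m \<ge> 2"
  obtains w where "lam = word_coloring w"
proof -
  obtain xs where lam: "lam = Coloring e1 e1 xs"
    using assms(1,2) by (cases lam) (auto simp: trivial_coloring_def)
  have "v \<in> range emb" if v: "v \<in> set xs" for v
  proof -
    obtain i where i: "i < length xs" "xs ! i = v" using v by (auto simp: in_set_conv_nth)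
    have "coloring m (Coloring e1 e1 xs)" using assms(1) lam by (simp add: trivial_coloring_def)
    note sides = iffD1[OF coloring_iff[OF assms(3)] this]
    then have "i < m" using i(1) by simp
    then have "distinct [e1, v, xs ! (Suc i mod m)] \<and> vec.independent {e1, v, xs ! (Suc i mod m)}"
      using conjunct2[OF sides] i(2) by metis
    then have "v \<noteq> 0" "v \<noteq> e1" using independent3_iff by blast+
    then show ?thesis using vec_cases by blast
  qed
  then have "map (emb \<circ> inv emb) xs = xs" by (intro map_idI) (simp add: f_inv_into_f)
  then have "lam = word_coloring (map (inv emb) xs)"
    using lam by (simp add: word_coloring_def)
  then show ?thesis by (rule that)
qed

section \<open>Moves of words as sector operations\<close>

lemma on_block_word:
  assumes "k = length u" "l = Suc (length u + length v)"
  shows "on_block k l f (u @ x # v @ y # z) = u @ f (x # v @ [y]) @ z"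
  using assms by (simp add: on_block_def)

lemma span_e1_emb: "vec.span {e1, emb (t, b)} = {0, e1, emb (t, b), emb (t, \<not> b)}"
  by (simp add: span_pair emb_bar add.commute[of e1])

lemma wstep_sector_step:
  assumes "wstep w w'"
  shows "sector_step (word_coloring w) (word_coloring w')"
  using assms
proof cases
  case (act p f)
  then obtain \<sigma> where \<sigma>: "lin \<sigma>" "bij \<sigma>" "\<sigma> e1 = e1" "\<And>x. \<sigma> (emb x) = emb (act p f x)"
    using act_linear by blast
  then show ?thesis using sector_step.DJ[OF \<sigma>(1,2), of e1 e1 "map emb w"] act
    by (simp add: word_coloring_def comp_def)
next
  case (rot u v)
  then show ?thesis
    using sector_step.rotation[of e1 e1 "map emb w" "length u"]
      rotate_append[of "map emb u" "map emb v"]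
    by (simp add: word_coloring_def)
next
  case (O1 u x v z)
  then show ?thesis
    using sector_step.O1[of "length u" "Suc (length u + length v)" "map emb w" e1 e1]
    by (simp add: word_coloring_def on_block_word nth_append rev_map)
next
  case (O21 b c u t v z)
  have "additive (\<lambda>s. s \<noteq> t)" by (cases t) (auto simp: additive_def)
  then obtain T where T: "lin T" "T e1 = e1" "\<And>x. T (emb x) = emb (act id (\<lambda>s. s \<noteq> t) x)"
    using act_linear[of id "\<lambda>s. s \<noteq> t"] by auto
  have c: "c = (\<not> b)" using O21 by auto
  have "T 0 = 0" using T(1) by (simp add: vec.linear_0)
  then have "T v = v" if "v \<in> vec.span {e1, emb (t, b)}" for v
    using that T unfolding span_e1_emb by auto
  \<comment> \<open>Outside the span only letters of types other than \<open>t\<close> remain, and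
    each of them changes its bar.\<close>
  moreover have "T v = v + e1" if "v \<notin> vec.span {e1, emb (t, b)}" for v
  proof -
    obtain s d where v: "v = emb (s, d)" using vec_cases[of v] \<open>v \<notin> _\<close> by (force simp: span_e1_emb)
    then have "s \<noteq> t" using \<open>v \<notin> _\<close> by (cases "d = b") (auto simp: span_e1_emb)
    then show ?thesis by (simp add: v T emb_bar)
  qed
  ultimately show ?thesis
    using sector_step.O21[of "length u" "Suc (length u + length v)" "map emb w" e1 T e1] T O21
    by (simp add: word_coloring_def on_block_word nth_append emb_bar c comp_def)
next
  case (O22 b c t t' u v z)
  let ?f = "\<lambda>s. s = t \<or> s = t'"
  have "additive ?f" using O22 by (cases t; cases t') (auto simp: additive_def)
  then obtain T where T: "lin T" "T e1 = e1" "\<And>x. T (emb x) = emb (act id ?f x)"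
    using act_linear[of id ?f] by auto
  have c: "c = (\<not> b)" using O22 by auto
  \<comment> \<open>A vector of the third type is fixed by \<open>T\<close> and serves as
    \<open>w\<close>.\<close>
  obtain r where r: "r \<noteq> t" "r \<noteq> t'" by (metis ty.distinct)
  show ?thesis
    using sector_step.O22[of "length u" "Suc (length u + length v)" "map emb w" e1 "emb (r, b)" T e1]
      T O22 r basis3_emb[of "(t, b)" "(r, b)"]
    by (simp add: word_coloring_def on_block_word nth_append emb_bar c comp_def rev_map)
next
  case (O32 x y u v z)
  have "additive (\<lambda>t. (t = fst x \<or> t = fst y) \<and> snd x \<noteq> snd y)"
    using O32 by (cases "fst x"; cases "fst y") (auto simp: additive_def)
  then obtain T where T: "lin T" "T e1 = e1" "\<And>a. T (emb a) = emb (swap x y a)"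
    using act_linear[OF inj_exchange] unfolding swap_def by blast
  have "swap x y x = y" "swap x y y = x"
    by (cases x; cases y; auto simp: swap_def)+
  then show ?thesis
    using sector_step.O32[of "length u" "Suc (length u + length v)" "map emb w" e1 T e1]
      T O32 basis3_emb[of x y]
    by (simp add: word_coloring_def on_block_word nth_append comp_def rev_map)
qed

text \<open>Every intermediate coloring must be trivial too, which follows from the invariance of
  length and properness.\<close>

lemma wsteps_sector_equivalent:
  assumes "wstep\<^sup>*\<^sup>* w w'" "proper (map fst w)" "length w = m" "m \<ge> 2"
  shows "sector_equivalent m (word_coloring w) (word_coloring w')"
  using assms
proof (induction rule: rtranclp_induct)
  case base
  then show ?case by (simp add: sector_equivalent_def)
next
  case (step v v')
  have "trivial_coloring m (word_coloring v)" "trivial_coloring m (word_coloring v')"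
    using step wsteps_length wsteps_proper wstep_length wstep_proper
    by (auto simp: trivial_word_coloring_iff)
  then have "equivclp (\<lambda>lam mu. trivial_coloring m lam \<and> trivial_coloring m mu \<and> sector_step lam mu)
      (word_coloring v) (word_coloring v')"
    using wstep_sector_step[OF step(2)] by (intro r_into_equivclp) blast
  then show ?case using step unfolding sector_equivalent_def by (meson equivclp_trans)
qed

text \<open>By additivity all letters lie in the plane spanned by \<open>emb (A, f A)\<close> and
  \<open>emb (B, f B)\<close>, and both of these occur.\<close>

lemma flat_two_independent:
  assumes "flat w" "{A, B} \<subseteq> fst ` set w"
  shows "two_independent (word_coloring w)"
proof -
  obtain f where f: "additive f" "\<And>x. x \<in> set w \<Longrightarrow> snd x = f (fst x)"
    using assms(1) by (auto simp: flat_def)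
  let ?u = "emb (A, f A)" and ?v = "emb (B, f B)"
  have "?u + ?v = emb (C, f C)"
    using f(1) by (auto simp: to_comb comb_eq_iff additive_def)
  then have "emb x \<in> vec.span {?u, ?v}" if "x \<in> set w" for x
    using f(2)[OF that] by (cases x; cases "fst x") (auto simp: span_pair)
  moreover have "(A, f A) \<in> set w" "(B, f B) \<in> set w"
    using assms(2) f(2) by force+
  ultimately have "vec.span (emb ` set w) = vec.span {?u, ?v}"
    by (subst vec.span_eq) (auto intro: vec.span_base)
  moreover have "vec.independent {?u, ?v}" "card {?u, ?v} = 2"
    using independent2_iff[of ?u ?v] by (auto simp: emb_eq_iff)
  ultimately show ?thesis
    by (simp add: two_independent_def word_coloring_def vec.dim_eq_card_independent)
qed

end

section \<open>Canonical colorings as words\<close>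

context basis
begin

lemma map_emb_zig: "map emb (zig A B (replicate (2 * k) False)) = concat (replicate k [\<alpha>, \<beta>])"
  by (induction k) (auto simp: emb.simps)

lemma concat_pairs: "even n \<Longrightarrow> concat (replicate (n div 2) [\<alpha>, \<beta>]) = map emb (zig A B (replicate n False))"
  by (auto simp: map_emb_zig elim!: evenE)

end

theorem proposition5p4:
  fixes m :: nat and lam :: facet_coloring and e1 \<alpha> \<beta> :: vec3
  assumes "m > 4"
    and "basis3 e1 \<alpha> \<beta>"
    and "trivial_coloring m lam"
    and "ceil_col lam = e1" and "floor_col lam = e1"
    and "three_independent lam"
    and "property_star e1 \<alpha> \<beta> lam"
  shows "(odd m \<and> sector_equivalent m lam (lam_C5 e1 \<alpha> \<beta> m)) \<or>
         (odd m \<and> sector_equivalent m lam (lam_C6 e1 \<alpha> \<beta> m)) \<or>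
         (odd m \<and> sector_equivalent m lam (lam_C7 e1 \<alpha> \<beta> m)) \<or>
         (even m \<and> sector_equivalent m lam (lam_C8 e1 \<alpha> \<beta> m)) \<or>
         (even m \<and> sector_equivalent m lam (lam_C9 e1 \<alpha> \<beta> m)) \<or>
         (even m \<and> sector_equivalent m lam (lam_C10 e1 \<alpha> \<beta> m))"
proof -
  interpret basis e1 \<alpha> \<beta> by unfold_locales (rule assms(2))
  have "m \<ge> 2" using assms(1) by simp
  obtain w where lam: "lam = word_coloring w"
    using trivial_coloring_word assms(3,4) \<open>m \<ge> 2\<close> by blast
  then have w: "length w = m" "proper (map fst w)"
    using assms(3) trivial_word_coloring_iff[OF \<open>m \<ge> 2\<close>] by auto
  have types: "{A, B, C} \<subseteq> fst ` set w"
  proof -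
    have "t \<in> fst ` set w" for t
    proof -
      have "emb (t, False) \<in> {\<alpha>, \<beta>, \<alpha> + \<beta>}" by (cases t) (auto simp: emb.simps)
      then have "emb (t, False) \<in> emb ` set w \<or> emb (t, False) + e1 \<in> emb ` set w"
        using assms(7) unfolding property_star_def lam word_coloring_def by auto
      then obtain x where "x \<in> set w" "emb x = emb (t, False) \<or> emb x = emb (t, True)"
        by (auto simp: emb_bar)
      then show ?thesis by (force simp: emb_eq_iff)
    qed
    then show ?thesis by blast
  qed
  then have "\<not> flat w"
    using flat_two_independent assms(6) lam by (auto simp: three_independent_def)
  note reach = wsteps_canonical[OF w(2) types this w(1) assms(1)]
  have equiv: "sector_equivalent m lam (word_coloring w')" if "wstep\<^sup>*\<^sup>* w w'" for w'
    using wsteps_sector_equivalent[OF that w(2,1) \<open>m \<ge> 2\<close>] lam by simp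
  show ?thesis
  proof (cases "odd m")
    case True
    then have tails: "concat (replicate ((m - 1) div 2) [\<alpha>, \<beta>]) = map emb (zig A B (replicate (m - 1) False))"
      "concat (replicate ((m - 3) div 2) [\<alpha>, \<beta>]) = map emb (zig A B (replicate (m - 3) False))"
      using concat_pairs[of "m - 1"] concat_pairs[of "m - 3"] assms(1) by auto
    \<comment> \<open>The first unbarred letter after the barred \<alpha> is the \<beta> that ends
      the three-letter prefix of \<open>lam_C6\<close> and \<open>lam_C7\<close>.\<close>
    have "m - 2 = Suc (m - 3)" using assms(1) by simp
    then have canon: "word_coloring ((C, True) # zig A B (replicate (m - 1) False)) = lam_C5 e1 \<alpha> \<beta> m"
      "word_coloring ((C, True) # zig A B (True # replicate (m - 2) False)) = lam_C6 e1 \<alpha> \<beta> m"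
      "word_coloring ((C, False) # zig A B (True # replicate (m - 2) False)) = lam_C7 e1 \<alpha> \<beta> m"
      using tails by (simp_all add: word_coloring_def lam_C5_def lam_C6_def lam_C7_def canonical_def
          emb.simps numeral_3_eq_3)
    consider "wstep\<^sup>*\<^sup>* w ((C, True) # zig A B (replicate (m - 1) False))"
      | c where "wstep\<^sup>*\<^sup>* w ((C, c) # zig A B (True # replicate (m - 2) False))"
      using reach True by auto
    then show ?thesis
    proof cases
      case 1
      then show ?thesis using equiv canon True by metis
    next
      case (2 c)
      then show ?thesis using equiv[OF 2] canon True by (cases c) simp_all
    qed
  next
    case False
    then have tails: "concat (replicate ((m - 2) div 2) [\<alpha>, \<beta>]) = map emb (zig A B (replicate (m - 2) False))"
      "concat (replicate ((m - 4) div 2) [\<alpha>, \<beta>]) = map emb (zig A B (replicate (m - 4) False))"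
      using concat_pairs[of "m - 2"] concat_pairs[of "m - 4"] assms(1) by auto
    \<comment> \<open>Likewise one unbarred \<beta> belongs to the four-letter prefix of
      \<open>lam_C8\<close> and \<open>lam_C9\<close>.\<close>
    have "m - 3 = Suc (m - 4)" using assms(1) by simp
    then have canon: "word_coloring ((A, False) # (C, True) # zig A B (replicate (m - 2) False)) = lam_C10 e1 \<alpha> \<beta> m"
      "word_coloring ((A, True) # (C, False) # zig A B (True # replicate (m - 3) False)) = lam_C8 e1 \<alpha> \<beta> m"
      "word_coloring ((A, False) # (C, False) # zig A B (True # replicate (m - 3) False)) = lam_C9 e1 \<alpha> \<beta> m"
      using tails by (simp_all add: word_coloring_def lam_C8_def lam_C9_def lam_C10_def canonical_def
          emb.simps eval_nat_numeral)
    consider "wstep\<^sup>*\<^sup>* w ((A, False) # (C, True) # zig A B (replicate (m - 2) False))"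
      | d where "wstep\<^sup>*\<^sup>* w ((A, d) # (C, False) # zig A B (True # replicate (m - 3) False))"
      using reach False by auto
    then show ?thesis
    proof cases
      case 1
      then show ?thesis using equiv canon False by metis
    next
      case (2 d)
      then show ?thesis using equiv[OF 2] canon False by (cases d) simp_all
    qed
  qed
qed

end
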